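(* Let $(\eta;\xi_i,1\le i\le^*N)$ have a given joint law with $N\in\{0,1,\dots,\infty\}$ random, $0\le\xi_i<1$, $\eta\ge0$ and $\mathbb E[\eta^p]<\infty$ for all $p\ge1$. For $p\ge1$ let $c(p)=\sum_{i\ge1}\mathbb E[\xi_i^p]\in[0,\infty]$ (with $\xi_i:=0$ for $i>N$), and suppose $c(p)<\infty$ for some $p\ge1$. Let $T$ be the map induced by the recursive distributional equation $$X\stackrel d=\eta+\sup_{i\le^*N}\xi_iX_i\qquad\text{on }[0,\infty).$$ (a) The discounted tree sum $X$ defined below is a.s. finite, its law $\mu$ is a solution of the equation with all moments finite, the associated invariant RTP is endogenous, and $T^n(\delta_0)\to\mu$ weakly. (b) For any $p\ge1$ with $c(p)<1$, $T$ maps $\mathcal F_p$ into itself and is a strict contraction on $(\mathcal F_p,d_p)$ with $d_p(T\mu_1,T\mu_2)\le c(p)^{1/p}d_p(\mu_1,\mu_2)$; consequently $\mu$ is the unique solution with finite $p$-th moment and $T^n(\mu_0)\to\mu$ for every $\mu_0\in\mathcal F_p$.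
   Context: $i\le^*N$ means $i\le N$ if $N<\infty$ and $i<\infty$ if $N=\infty$; the sup over an empty set is $0$. $T$ sends a law $\mu$ on $[0,\infty)$ to the law of $\eta+\sup_{i\le^*N}\xi_iX_i$ with $X_i$ i.i.d. $\mu$ independent of $(\eta;\xi_i)$. Discounted tree sum: let $\mathcal T$ be the Galton–Watson tree with vertices finite words of positive integers, where each vertex $\mathbf i$ carries an independent copy $(\eta_{\mathbf i};\xi_{\mathbf ij},j\le^*N_{\mathbf i})$ of $(\eta;\xi_j,j\le^*N)$ and has children $\mathbf ij$, $j\le^*N_{\mathbf i}$; $\xi_{\mathbf ij}$ is the weight of the edge $(\mathbf i,\mathbf ij)$. For a finite path $\pi=(\emptyset=v_0,v_1,\dots,v_k)$ from the root in $\mathcal T$ set $W(\pi)=\sum_{d=0}^k\eta_{v_d}\prod_{j=1}^d\xi_{v_j}$ (where $\xi_{v_j}$ is the weight of edge $(v_{j-1},v_j)$), and $X=\sup_\pi W(\pi)$. $\mathcal F_p$ is the set of laws on $[0,\infty)$ with finite $p$-th moment and $d_p(\mu,\nu)=\inf\{(\mathbb E|Z-W|^p)^{1/p}:Z\sim\mu,W\sim\nu\}$ the Wasserstein metric. Invariant RTP and endogeny: a family $(X_{\mathbf i})$ indexed by all finite words, each with law $\mu$, with $X_{\mathbf i}=\eta_{\mathbf i}+\sup_{j\le^*N_{\mathbf i}}\xi_{\mathbf ij}X_{\mathbf ij}$ a.s., generation-$d$ variables i.i.d. and independent of the data at generations $<d$; endogenous means $X_\emptyset$ is measurable w.r.t.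 the $\sigma$-field generated by all the data. *)

theory Defs
  imports "HOL-Probability.Probability"
begin

text \<open>Per-vertex data (eta; xi_j; N).  Children are indexed by j :: nat starting at 0,
  so child j exists iff enat j < N (this is i = j+1 with i \<le>* N).\<close>
type_synonym dat = "real \<times> (nat \<Rightarrow> real) \<times> enat"

definition eta :: "dat \<Rightarrow> real" where "eta d = fst d"
definition xi :: "dat \<Rightarrow> nat \<Rightarrow> real" where "xi d = fst (snd d)"
definition NN :: "dat \<Rightarrow> enat" where "NN d = snd (snd d)"

definition Dspace :: "dat measure" where
  "Dspace = borel \<Otimes>\<^sub>M ((\<Pi>\<^sub>M j\<in>(UNIV::nat set). (borel::real measure)) \<Otimes>\<^sub>M count_space UNIV)"

definition cfun :: "dat measure \<Rightarrow> real \<Rightarrow> ennreal" where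
  "cfun D p = (\<Sum>j. \<integral>\<^sup>+ d. (if enat j < NN d then ennreal (xi d j powr p) else 0) \<partial>D)"

text \<open>eta + sup_{i \<le>* N} xi_i x_i, computed in [0,\<infinity>] (sup over empty set is 0).\<close>
definition rde_sup :: "dat \<Rightarrow> (nat \<Rightarrow> real) \<Rightarrow> ennreal" where
  "rde_sup d x = ennreal (eta d) + (SUP j\<in>{j. enat j < NN d}. ennreal (xi d j) * ennreal (x j))"

definition Tmap :: "dat measure \<Rightarrow> real measure \<Rightarrow> real measure" where
  "Tmap D \<mu> = distr (D \<Otimes>\<^sub>M (\<Pi>\<^sub>M j\<in>(UNIV::nat set). \<mu>)) borel
      (\<lambda>z. enn2real (rde_sup (fst z) (snd z)))"

definition Fp :: "real \<Rightarrow> real measure \<Rightarrow> bool" where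
  "Fp p \<mu> \<longleftrightarrow> real_distribution \<mu> \<and> (AE x in \<mu>. 0 \<le> x) \<and>
      (\<integral>\<^sup>+ x. ennreal (\<bar>x\<bar> powr p) \<partial>\<mu>) < \<infinity>"

definition couplings :: "real measure \<Rightarrow> real measure \<Rightarrow> (real \<times> real) measure set" where
  "couplings \<mu> \<nu> = {\<pi>. prob_space \<pi> \<and> sets \<pi> = sets (borel \<Otimes>\<^sub>M borel) \<and>
      distr \<pi> borel fst = \<mu> \<and> distr \<pi> borel snd = \<nu>}"

definition wass :: "real \<Rightarrow> real measure \<Rightarrow> real measure \<Rightarrow> real" where
  "wass p \<mu> \<nu> = enn2real (INF \<pi>\<in>couplings \<mu> \<nu>. \<integral>\<^sup>+ z. ennreal (\<bar>fst z - snd z\<bar> powr p) \<partial>\<pi>)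
      powr (1 / p)"

text \<open>Galton-Watson tree: vertices are words (lists); vertex v@[j] is the j-th child of v.
  omega v is the data carried by vertex v.\<close>
definition tree_space :: "dat measure \<Rightarrow> (nat list \<Rightarrow> dat) measure" where
  "tree_space D = (\<Pi>\<^sub>M v\<in>(UNIV::nat list set). D)"

definition in_tree :: "(nat list \<Rightarrow> dat) \<Rightarrow> nat list \<Rightarrow> bool" where
  "in_tree \<omega> v \<longleftrightarrow> (\<forall>k<length v. enat (v ! k) < NN (\<omega> (take k v)))"

text \<open>W(pi) for the path from the root to v (v_d = take d v; the weight of edge
  (v_{j-1},v_j) is xi carried by v_{j-1} at index v!(j-1)).\<close>
definition path_weight :: "(nat list \<Rightarrow> dat) \<Rightarrow> nat list \<Rightarrow> real" where
  "path_weight \<omega> v = (\<Sum>d\<le>length v. eta (\<omega> (take d v)) *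
      (\<Prod>j\<in>{1..d}. xi (\<omega> (take (j - 1) v)) (v ! (j - 1))))"

definition tree_sum :: "(nat list \<Rightarrow> dat) \<Rightarrow> ennreal" where
  "tree_sum \<omega> = (SUP v\<in>{v. in_tree \<omega> v}. ennreal (path_weight \<omega> v))"

definition tree_law :: "dat measure \<Rightarrow> real measure" where
  "tree_law D = distr (tree_space D) borel (\<lambda>\<omega>. enn2real (tree_sum \<omega>))"

definition invariant_RTP :: "dat measure \<Rightarrow> real measure \<Rightarrow> 'a measure \<Rightarrow>
    (nat list \<Rightarrow> 'a \<Rightarrow> dat) \<Rightarrow> (nat list \<Rightarrow> 'a \<Rightarrow> real) \<Rightarrow> bool" where
  "invariant_RTP D \<mu> M dat Xr \<longleftrightarrow>
     prob_space M \<and>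
     (\<forall>v. dat v \<in> measurable M Dspace) \<and> (\<forall>v. Xr v \<in> borel_measurable M) \<and>
     distr M (\<Pi>\<^sub>M v\<in>(UNIV::nat list set). Dspace) (\<lambda>x v. dat v x) = (\<Pi>\<^sub>M v\<in>(UNIV::nat list set). D) \<and>
     (\<forall>v. distr M borel (Xr v) = \<mu>) \<and>
     (\<forall>v. AE x in M. ennreal (Xr v x) = rde_sup (dat v x) (\<lambda>j. Xr (v @ [j]) x)) \<and>
     (\<forall>n. prob_space.indep_vars M (\<lambda>_. borel) Xr {v. length v = n} \<and>
        (let A = (\<lambda>x. restrict (\<lambda>v. dat v x) {v. length v < n});
             SA = (\<Pi>\<^sub>M v\<in>{v. length v < n}. Dspace);
             B = (\<lambda>x. restrict (\<lambda>v. Xr v x) {v. length v = n});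
             SB = (\<Pi>\<^sub>M v\<in>{v. length v = n}. (borel::real measure))
         in distr M (SA \<Otimes>\<^sub>M SB) (\<lambda>x. (A x, B x)) = distr M SA A \<Otimes>\<^sub>M distr M SB B))"

definition endogenous_at :: "'a measure \<Rightarrow> (nat list \<Rightarrow> 'a \<Rightarrow> dat) \<Rightarrow> (nat list \<Rightarrow> 'a \<Rightarrow> real) \<Rightarrow> bool" where
  "endogenous_at M dat Xr \<longleftrightarrow>
     (\<exists>f\<in>borel_measurable (\<Pi>\<^sub>M v\<in>(UNIV::nat list set). Dspace). AE x in M. Xr [] x = f (\<lambda>v. dat v x))"

end

theory Submission
  imports Defs
begin

text \<open>
  Cut off at depth \<open>n\<close>, the tree sum has law \<open>T\<^sup>n \<delta>\<^sub>0\<close>, because a tree is its root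
  data together with countably many independent copies of itself grafted onto the children.
  For \<open>0 < l < 1\<close>, convexity of the \<open>p\<close>-th power gives
  \<open>E (T\<mu>)\<^sup>p \<le> l powr (1-p) * E \<eta>\<^sup>p + (1-l) powr (1-p) * c(p) * E \<mu>\<^sup>p\<close>, and if \<open>c(p) < 1\<close> then
  the coefficient of \<open>E \<mu>\<^sup>p\<close> is below 1 for small \<open>l\<close>. Hence the
  truncated sums have bounded \<open>p\<close>-th moments, and monotone convergence makes the tree sum finite.
  Some (large) \<open>p\<close> with \<open>c(p) < 1\<close> exists by dominated convergence, as \<open>\<xi> < 1\<close>.
  Contraction comes from applying the recursion to i.i.d. copies of a coupling:
  \<open>\<bar>sup \<xi>\<^sub>j x\<^sub>j - sup \<xi>\<^sub>j y\<^sub>j\<bar>\<^sup>p \<le> \<Sum> \<xi>\<^sub>j\<^sup>p \<bar>x\<^sub>j - y\<^sub>j\<bar>\<^sup>p\<close>.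
\<close>

text \<open>Suprema are taken in \<open>ennreal\<close> while laws live on \<open>real\<close>, and
  \<open>enn2real\<close> sends infinity to 0. A law identity obtained through
  \<open>enn2real\<close> is therefore faithful only where the supremum behind it is almost surely
  finite. This is why finiteness accompanies every step: it passes through the truncated sums by
  induction, and reaches the full sum by a moment bound that is uniform in the depth. The tree law
  supplies the fixed point explicitly, so contraction serves to compare other laws with it: iterates
  approach it geometrically, and a second fixed point has distance 0 from it. To turn distances into
  statements about laws, Markov's inequality is applied to each coupling and the infimum over
  couplings is taken afterwards. The resulting comparison of distribution functions gives weak
  convergence and also shows that laws at distance 0 agree.\<close>

definition wgt :: "dat \<Rightarrow> nat \<Rightarrow> real" where
  "wgt d j = (if enat j < NN d then max 0 (xi d j) else 0)"

section \<open>Edge weights, and inequalities for suprema and powers\<close>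

lemma wgt_nonneg [simp]: "0 \<le> wgt d j"
  by (simp add: wgt_def)

text \<open>An absent child gets weight 0, and a term 0 does not change a supremum in [0, infinity],
  where the empty supremum is 0 too. This removes the random index set, so that measurability and
  series run over all \<open>j\<close>. Clipping at 0 agrees with what \<open>ennreal\<close> does
  to negative weights, so the identity holds for every \<open>d\<close>.\<close>

lemma rde_sup_eq_wgt:
  "rde_sup d x = ennreal (eta d) + (SUP j. ennreal (wgt d j) * ennreal (x j))"
proof -
  have e: "ennreal (max 0 r) = ennreal r" for r
    by (auto simp: max_def ennreal_neg)
  have "(SUP j\<in>{j. enat j < NN d}. ennreal (xi d j) * ennreal (x j))
      = (SUP j. ennreal (wgt d j) * ennreal (x j))"
  proof (rule antisym)
    show "(SUP j\<in>{j. enat j < NN d}. ennreal (xi d j) * ennreal (x j))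
        \<le> (SUP j. ennreal (wgt d j) * ennreal (x j))"
      by (rule SUP_mono) (auto simp: wgt_def e intro!: exI)
    show "(SUP j. ennreal (wgt d j) * ennreal (x j))
        \<le> (SUP j\<in>{j. enat j < NN d}. ennreal (xi d j) * ennreal (x j))"
      by (rule SUP_least) (auto simp: wgt_def e intro!: SUP_upper)
  qed
  then show ?thesis by (simp add: rde_sup_def)
qed

text \<open>Each \<open>a j\<close> is at most the p-th root of \<open>s\<close>. In the
  applications \<open>s\<close> is the sum or the supremum of the p-th powers, so the first case is
  the domination of the supremum norm by the l^p norm. An infinite \<open>s\<close> makes the first
  claim trivial.\<close>

lemma powr_SUP_le:
  fixes a :: "nat \<Rightarrow> real"
  assumes "0 < p" and a: "\<And>j. 0 \<le> a j" "\<And>j. ennreal (a j powr p) \<le> s"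
  shows "ennreal (enn2real (SUP j. ennreal (a j)) powr p) \<le> s"
    and "s < \<infinity> \<Longrightarrow> (SUP j. ennreal (a j)) < \<infinity>"
proof -
  have fin: "(SUP j. ennreal (a j)) \<le> ennreal (enn2real s powr (1/p))" if "s < \<infinity>"
  proof (rule SUP_least)
    fix j
    have "a j powr p \<le> enn2real s"
      using a(2)[of j] that by (cases s) (auto simp: ennreal_le_iff)
    then have "(a j powr p) powr (1/p) \<le> enn2real s powr (1/p)"
      using \<open>0 < p\<close> by (intro powr_mono2) auto
    then show "ennreal (a j) \<le> ennreal (enn2real s powr (1/p))"
      using \<open>0 < p\<close> a(1)[of j] by (simp add: powr_powr ennreal_leI)
  qed
  then show "s < \<infinity> \<Longrightarrow> (SUP j. ennreal (a j)) < \<infinity>"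
    by (metis ennreal_less_top infinity_ennreal_def order_le_less_trans)
  show "ennreal (enn2real (SUP j. ennreal (a j)) powr p) \<le> s"
  proof (cases "s < \<infinity>")
    case True
    have "enn2real (SUP j. ennreal (a j)) \<le> enn2real s powr (1/p)"
      using fin[OF True] by (simp add: enn2real_leI)
    then have "enn2real (SUP j. ennreal (a j)) powr p \<le> (enn2real s powr (1/p)) powr p"
      using \<open>0 < p\<close> by (intro powr_mono2) auto
    also have "\<dots> = enn2real s"
      using \<open>0 < p\<close> by (simp add: powr_powr)
    finally show ?thesis
      using True by (metis ennreal_enn2real ennreal_leI infinity_ennreal_def)
  qed (auto simp: not_less top_unique)
qed

text \<open>Convexity of the power at \<open>a + b = l * (a / l) + (1 - l) * (b / (1 - l))\<close>.
  Keeping \<open>l\<close> free matters: as \<open>l\<close> tends to 0 the factor of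
  \<open>b powr p\<close> tends to 1, at the price of a large factor of \<open>a powr p\<close>.
  When \<open>a\<close> or \<open>b\<close> vanishes it suffices that both factors are at least
  1.\<close>

lemma powr_add_le_weighted:
  fixes a b l p :: real
  assumes "0 \<le> a" "0 \<le> b" "0 < l" "l < 1" "1 \<le> p"
  shows "(a + b) powr p \<le> l powr (1 - p) * a powr p + (1 - l) powr (1 - p) * b powr p"
proof -
  have one: "1 \<le> x powr (1 - p)" if "0 < x" "x < 1" for x :: real
    using powr_mono'[of "1 - p" 0 x] that assms by simp
  consider "a = 0" | "b = 0" | "0 < a" "0 < b" using assms by linarith
  then show ?thesis
  proof cases
    case 1
    then show ?thesis using one[of "1 - l"] assms mult_right_mono[of 1 _ "b powr p"] by simp
  next
    case 2
    then show ?thesis using one[of l] assms mult_right_mono[of 1 _ "a powr p"] by simp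
  next
    case 3
    have "(l * (a / l) + (1 - l) * (b / (1 - l))) powr p
        \<le> l * (a / l) powr p + (1 - l) * (b / (1 - l)) powr p"
      using convex_onD[OF powr_convex[OF \<open>1 \<le> p\<close>], of "1 - l" "a / l" "b / (1 - l)"] assms 3
      by (simp del: times_divide_eq_right times_divide_eq_left nonzero_mult_div_cancel_left)
    moreover have "l * (a / l) powr p = l powr (1 - p) * a powr p"
      using assms by (simp add: powr_divide powr_diff)
    moreover have "(1 - l) * (b / (1 - l)) powr p = (1 - l) powr (1 - p) * b powr p"
      using assms by (simp add: powr_divide powr_diff)
    ultimately show ?thesis using assms by simp
  qed
qed

section \<open>Infinite products\<close>

lemma prob_PiM_UNIV: "prob_space M \<Longrightarrow> prob_space (\<Pi>\<^sub>M i\<in>(UNIV::'i set). M)"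
  by (rule prob_space_PiM)

lemma AE_PiM_UNIV:
  assumes "prob_space M" "AE x in M. P x"
  shows "AE f in (\<Pi>\<^sub>M i\<in>(UNIV::'i set). M). P (f i)"
proof -
  interpret product_prob_space "\<lambda>_::'i. M" UNIV
    using assms(1) by (simp add: product_prob_space_def product_prob_space_axioms_def
        product_sigma_finite_def prob_space_imp_sigma_finite)
  show ?thesis using AE_component[of i P] assms(2) by simp
qed

text \<open>A finite measure on an infinite product is determined by its values on cylinders. A
  coordinatewise map pulls a cylinder back to a cylinder, so both sides give the same finite
  product.\<close>

lemma distr_PiM_map:
  assumes "prob_space M" and g [measurable]: "g \<in> measurable M N"
  shows "distr (\<Pi>\<^sub>M i\<in>(UNIV::'i set). M) (\<Pi>\<^sub>M i\<in>UNIV. N) (\<lambda>f i. g (f i)) = (\<Pi>\<^sub>M i\<in>UNIV. distr M N g)"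
proof -
  interpret M: prob_space M by fact
  interpret N: prob_space "distr M N g" by (rule M.prob_space_distr) fact
  have [measurable]: "(\<lambda>f i. g (f i)) \<in> measurable (\<Pi>\<^sub>M i\<in>(UNIV::'i set). M) (\<Pi>\<^sub>M i\<in>UNIV. N)"
  proof (rule measurable_PiM_single')
    show "(\<lambda>f. g (f i)) \<in> measurable (\<Pi>\<^sub>M i\<in>(UNIV::'i set). M) N" for i
      by (rule measurable_compose[OF measurable_component_singleton[of i UNIV "\<lambda>_. M"] g]) simp
    show "(\<lambda>f i. g (f i)) \<in> space (\<Pi>\<^sub>M i\<in>(UNIV::'i set). M) \<rightarrow> (\<Pi>\<^sub>E i\<in>UNIV. space N)"
      using measurable_space[OF g] by (auto simp: space_PiM PiE_UNIV_domain Pi_iff)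
  qed
  have "(\<Pi>\<^sub>M i\<in>(UNIV::'i set). distr M N g)
      = distr (\<Pi>\<^sub>M i\<in>(UNIV::'i set). M) (\<Pi>\<^sub>M i\<in>UNIV. N) (\<lambda>f i. g (f i))"
  proof (rule measure_eqI_PiM_infinite[OF refl])
    show "sets (distr (\<Pi>\<^sub>M i\<in>(UNIV::'i set). M) (\<Pi>\<^sub>M i\<in>UNIV. N) (\<lambda>f i. g (f i)))
        = sets (\<Pi>\<^sub>M i\<in>UNIV. distr M N g)"
      unfolding sets_distr by (rule sets_PiM_cong) simp_all
    show "finite_measure (\<Pi>\<^sub>M i\<in>(UNIV::'i set). distr M N g)"
      by (rule prob_space.axioms(1)[OF prob_PiM_UNIV[OF N.prob_space_axioms]])
    fix A :: "'i \<Rightarrow> 'b set" and J :: "'i set"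
    assume J: "finite J" and A: "\<And>i. i \<in> J \<Longrightarrow> A i \<in> sets (distr M N g)"
    have emb: "prod_emb UNIV (\<lambda>_. distr M N g) J (Pi\<^sub>E J A) = prod_emb UNIV (\<lambda>_. N) J (Pi\<^sub>E J A)"
      by (simp add: prod_emb_def space_PiM)
    have "emeasure (distr (\<Pi>\<^sub>M i\<in>(UNIV::'i set). M) (\<Pi>\<^sub>M i\<in>UNIV. N) (\<lambda>f i. g (f i)))
          (prod_emb UNIV (\<lambda>_. distr M N g) J (Pi\<^sub>E J A))
        = emeasure (\<Pi>\<^sub>M i\<in>(UNIV::'i set). M)
            (prod_emb UNIV (\<lambda>_. M) J (\<Pi>\<^sub>E i\<in>J. g -` A i \<inter> space M))"
    proof -
      have "prod_emb UNIV (\<lambda>_. N) J (Pi\<^sub>E J A) \<in> sets (\<Pi>\<^sub>M i\<in>UNIV. N)"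
        using J A by (intro sets_PiM_I) auto
      moreover have "(\<lambda>f i. g (f i)) -` prod_emb UNIV (\<lambda>_. N) J (Pi\<^sub>E J A)
          \<inter> space (\<Pi>\<^sub>M i\<in>(UNIV::'i set). M)
        = prod_emb UNIV (\<lambda>_. M) J (\<Pi>\<^sub>E i\<in>J. g -` A i \<inter> space M)"
        using measurable_space[OF g] by (auto simp: prod_emb_def space_PiM PiE_iff)
      ultimately show ?thesis unfolding emb by (subst emeasure_distr) auto
    qed
    also have "\<dots> = (\<Prod>i\<in>J. emeasure (distr M N g) (A i))"
      using J A M.prob_space_axioms by (subst emeasure_PiM_emb) (auto simp: emeasure_distr)
    also have "\<dots> = emeasure (\<Pi>\<^sub>M i\<in>UNIV. distr M N g) (prod_emb UNIV (\<lambda>_. distr M N g) J (Pi\<^sub>E J A))"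
      using J A N.prob_space_axioms by (subst emeasure_PiM_emb) auto
    finally show "emeasure (\<Pi>\<^sub>M i\<in>UNIV. distr M N g) (prod_emb UNIV (\<lambda>_. distr M N g) J (Pi\<^sub>E J A))
        = emeasure (distr (\<Pi>\<^sub>M i\<in>(UNIV::'i set). M) (\<Pi>\<^sub>M i\<in>UNIV. N) (\<lambda>f i. g (f i)))
          (prod_emb UNIV (\<lambda>_. distr M N g) J (Pi\<^sub>E J A))" by simp
  qed
  then show ?thesis by simp
qed

section \<open>Assembling a tree from its root and the subtrees below the root\<close>

definition graft :: "'a \<times> (nat \<Rightarrow> nat list \<Rightarrow> 'a) \<Rightarrow> nat list \<Rightarrow> 'a" where
  "graft z v = (case v of [] \<Rightarrow> fst z | j # w \<Rightarrow> snd z j w)"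

lemma measurable_graft:
  "graft \<in> measurable (M \<Otimes>\<^sub>M (\<Pi>\<^sub>M j\<in>(UNIV::nat set). \<Pi>\<^sub>M w\<in>(UNIV::nat list set). M))
      (\<Pi>\<^sub>M v\<in>(UNIV::nat list set). M)"
proof (rule measurable_PiM_single')
  fix v :: "nat list"
  show "(\<lambda>z. graft z v) \<in> measurable (M \<Otimes>\<^sub>M (\<Pi>\<^sub>M j\<in>(UNIV::nat set). \<Pi>\<^sub>M w\<in>(UNIV::nat list set). M)) M"
  proof (cases v)
    case (Cons j w)
    have "(\<lambda>z. (snd z j) w) \<in> measurable (M \<Otimes>\<^sub>M (\<Pi>\<^sub>M j\<in>(UNIV::nat set). \<Pi>\<^sub>M w\<in>(UNIV::nat list set). M)) M"
      by (rule measurable_compose[OF _ measurable_component_singleton[of w UNIV]],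
          rule measurable_compose[OF measurable_snd measurable_component_singleton[of j UNIV]]) auto
    then show ?thesis by (simp add: Cons graft_def)
  qed (simp add: graft_def)
next
  show "graft \<in> space (M \<Otimes>\<^sub>M (\<Pi>\<^sub>M j\<in>(UNIV::nat set). \<Pi>\<^sub>M w\<in>(UNIV::nat list set). M))
      \<rightarrow> (\<Pi>\<^sub>E v\<in>UNIV. space M)"
    by (auto simp: space_pair_measure space_PiM graft_def PiE_iff split: list.split)
qed

text \<open>The branching property, put as an image measure so that root and subtrees live on a
  genuine product space. A cylinder over \<open>J\<close> pulls back to a condition on the root
  times a cylinder over finitely many subtrees, because the nonempty words of \<open>J\<close> can
  be sorted by their first letter.\<close>

lemma distr_graft:
  assumes "prob_space M"
  shows "distr (M \<Otimes>\<^sub>M (\<Pi>\<^sub>M j\<in>(UNIV::nat set). \<Pi>\<^sub>M w\<in>(UNIV::nat list set). M))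
      (\<Pi>\<^sub>M v\<in>(UNIV::nat list set). M) graft = (\<Pi>\<^sub>M v\<in>UNIV. M)"
    (is "distr ?P ?T graft = _")
proof -
  interpret M: prob_space M by fact
  let ?F = "\<Pi>\<^sub>M j\<in>(UNIV::nat set). ?T"
  interpret T: prob_space ?T by (rule prob_PiM_UNIV) fact
  interpret F: prob_space ?F by (rule prob_PiM_UNIV) (rule T.prob_space_axioms)
  note measurable_graft[of M, measurable]
  have "?T = distr ?P ?T graft"
  proof (rule measure_eqI_PiM_infinite[OF refl])
    show "finite_measure ?T" by (rule T.finite_measure_axioms)
    fix A :: "nat list \<Rightarrow> 'a set" and J :: "nat list set"
    assume J: "finite J" and A: "\<And>i. i \<in> J \<Longrightarrow> A i \<in> sets M"
    let ?X = "prod_emb UNIV (\<lambda>_. M) J (Pi\<^sub>E J A)"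
    \<comment> \<open>The whole space stands for a root left unconstrained by \<open>J\<close>.
      Below, \<open>Jj j\<close> holds the constraints inside the subtree at child \<open>j\<close>,
      and \<open>K\<close> the children whose subtree is constrained at all.\<close>
    define A0 where "A0 = (if [] \<in> J then A [] else space M)"
    define Jj where "Jj j = {w. j # w \<in> J}" for j
    define K where "K = {j. Jj j \<noteq> {}}"
    define B where "B j = prod_emb UNIV (\<lambda>_. M) (Jj j) (\<Pi>\<^sub>E w\<in>Jj j. A (j # w))" for j
    have fJ: "finite (Jj j)" for j
      using finite_vimageI[OF J, of "(#) j"] by (simp add: Jj_def vimage_def inj_on_def)
    have "K \<subseteq> hd ` J" by (force simp: K_def Jj_def)
    then have fK: "finite K" using J finite_surj by auto
    have A0: "A0 \<in> sets M" using A by (auto simp: A0_def)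
    have B: "B j \<in> sets ?T" for j
      unfolding B_def using fJ A by (intro sets_PiM_I) (auto simp: Jj_def)
    have Beq: "emeasure ?T (B j) = (\<Prod>w\<in>Jj j. emeasure M (A (j # w)))" for j
      unfolding B_def using fJ A M.prob_space_axioms by (subst emeasure_PiM_emb) (auto simp: Jj_def)
    have pre: "graft -` ?X \<inter> space ?P = A0 \<times> prod_emb UNIV (\<lambda>_. ?T) K (\<Pi>\<^sub>E j\<in>K. B j)" (is "?L = ?R")
    proof (intro set_eqI)
      fix z
      have sA: "A v \<subseteq> space M" if "v \<in> J" for v using A[OF that] sets.sets_into_space by blast
      show "z \<in> ?L \<longleftrightarrow> z \<in> ?R"
      proof (cases z)
        case (Pair d f)
        show ?thesis
        proof
          assume z: "z \<in> ?L"
          then have v: "graft z v \<in> A v" if "v \<in> J" for v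
            using that by (auto simp: prod_emb_def)
          from z have sp: "d \<in> space M" "\<And>j w. f j w \<in> space M"
            by (auto simp: Pair space_pair_measure space_PiM PiE_iff)
          have "d \<in> A0" using v[of "[]"] sp by (auto simp: A0_def graft_def Pair)
          moreover have "f j w \<in> A (j # w)" if "j # w \<in> J" for j w
            using v[OF that] by (simp add: graft_def Pair)
          ultimately show "z \<in> ?R"
            using sp by (auto simp: Pair prod_emb_def B_def K_def Jj_def space_PiM PiE_iff)
        next
          assume z: "z \<in> ?R"
          then have sp: "d \<in> A0" "\<And>j w. f j w \<in> space M"
            by (auto simp: Pair prod_emb_def space_PiM PiE_iff)
          have f: "f j w \<in> A (j # w)" if "j # w \<in> J" for j w
          proof -
            have "j \<in> K" using that by (auto simp: K_def Jj_def)
            then have "f j \<in> B j" using z by (auto simp: Pair prod_emb_def)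
            then show ?thesis using that by (auto simp: B_def prod_emb_def Jj_def)
          qed
          have d: "d \<in> space M" using sp(1) A0 sets.sets_into_space by blast
          have "graft z v \<in> A v" if "v \<in> J" for v
            using that f sp(1) by (cases v) (auto simp: graft_def Pair A0_def)
          moreover have "graft z v \<in> space M" for v
            using d sp by (cases v) (auto simp: graft_def Pair)
          ultimately show "z \<in> ?L"
            using d sp by (auto simp: Pair prod_emb_def space_PiM PiE_iff space_pair_measure)
        qed
      qed
    qed
    have "emeasure (distr ?P ?T graft) ?X = emeasure ?P (A0 \<times> prod_emb UNIV (\<lambda>_. ?T) K (\<Pi>\<^sub>E j\<in>K. B j))"
      unfolding pre[symmetric] using J A by (intro emeasure_distr) (auto intro!: sets_PiM_I)
    also have "\<dots> = emeasure M A0 * (\<Prod>j\<in>K. emeasure ?T (B j))"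
      using A0 B fK T.prob_space_axioms
      by (subst F.emeasure_pair_measure_Times) (auto intro!: sets_PiM_I simp: emeasure_PiM_emb)
    also have "(\<Prod>j\<in>K. emeasure ?T (B j)) = (\<Prod>(j,w)\<in>(SIGMA j:K. Jj j). emeasure M (A (j # w)))"
      unfolding Beq using fK fJ by (subst prod.Sigma) auto
    also have "\<dots> = (\<Prod>v\<in>J - {[]}. emeasure M (A v))"
      by (rule prod.reindex_bij_witness[of _ "\<lambda>v. (hd v, tl v)" "\<lambda>(j,w). j # w"])
        (auto simp: K_def Jj_def neq_Nil_conv)
    also have "emeasure M A0 * (\<Prod>v\<in>J - {[]}. emeasure M (A v)) = (\<Prod>v\<in>J. emeasure M (A v))"
      using J by (auto simp: A0_def M.emeasure_space_1 prod.remove[of J "[]"])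
    also have "\<dots> = emeasure ?T ?X"
      using J A M.prob_space_axioms by (subst emeasure_PiM_emb) auto
    finally show "emeasure ?T ?X = emeasure (distr ?P ?T graft) ?X" by simp
  qed simp
  then show ?thesis by simp
qed

section \<open>Truncated tree sums\<close>

definition admissible :: "dat \<Rightarrow> bool" where
  "admissible d \<longleftrightarrow> 0 \<le> eta d \<and> (\<forall>j. enat j < NN d \<longrightarrow> 0 \<le> xi d j \<and> xi d j < 1)"

lemma wgt_eq_xi: "admissible d \<Longrightarrow> enat j < NN d \<Longrightarrow> wgt d j = xi d j"
  by (simp add: admissible_def wgt_def)

text \<open>Depth \<open>\<infinity>\<close> is allowed, so that one recursion covers both the truncated and the full tree sum.\<close>
definition depth_sum :: "enat \<Rightarrow> (nat list \<Rightarrow> dat) \<Rightarrow> ennreal" where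
  "depth_sum n \<omega> = (SUP v\<in>{v. in_tree \<omega> v \<and> enat (length v) < n}. ennreal (path_weight \<omega> v))"

lemma in_tree_Nil [simp]: "in_tree \<omega> []"
  by (simp add: in_tree_def)

lemma in_tree_Cons:
  "in_tree \<omega> (j # w) \<longleftrightarrow> enat j < NN (\<omega> []) \<and> in_tree (\<lambda>v. \<omega> (j # v)) w"
  by (simp add: in_tree_def All_less_Suc2)

lemma path_weight_Nil [simp]: "path_weight \<omega> [] = eta (\<omega> [])"
  by (simp add: path_weight_def)

text \<open>Every summand except the one of the root contains the weight of the first edge. Taking
  it out leaves the path weight seen from the child, with all indices shifted by one.\<close>

lemma path_weight_Cons:
  "path_weight \<omega> (j # w) = eta (\<omega> []) + xi (\<omega> []) j * path_weight (\<lambda>v. \<omega> (j # v)) w"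
proof -
  have "(\<Prod>i\<in>{1..Suc d}. xi (\<omega> (take (i - 1) (j # w))) ((j # w) ! (i - 1)))
      = xi (\<omega> []) j * (\<Prod>i\<in>{1..d}. xi (\<omega> (j # take (i - 1) w)) (w ! (i - 1)))" for d
  proof -
    have "(\<Prod>i\<in>{1..Suc d}. xi (\<omega> (take (i - 1) (j # w))) ((j # w) ! (i - 1)))
      = xi (\<omega> []) j * (\<Prod>i\<in>{1..d}. xi (\<omega> (take i (j # w))) ((j # w) ! i))"
      by (subst prod.atLeast_Suc_atMost)
        (simp_all add: prod.atLeast_Suc_atMost_Suc_shift del: prod.cl_ivl_Suc)
    also have "(\<Prod>i\<in>{1..d}. xi (\<omega> (take i (j # w))) ((j # w) ! i))
      = (\<Prod>i\<in>{1..d}. xi (\<omega> (j # take (i - 1) w)) (w ! (i - 1)))"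
      by (rule prod.cong) (auto simp: take_Cons' nth_Cons')
    finally show ?thesis .
  qed
  then show ?thesis
    by (simp add: path_weight_def sum.atMost_Suc_shift sum_distrib_left mult_ac
        del: prod.cl_ivl_Suc sum.atMost_Suc)
qed

lemma path_weight_nonneg:
  "\<forall>v. admissible (\<omega> v) \<Longrightarrow> in_tree \<omega> v \<Longrightarrow> 0 \<le> path_weight \<omega> v"
proof (induction v arbitrary: \<omega>)
  case (Cons j w)
  then have "0 \<le> path_weight (\<lambda>v. \<omega> (j # v)) w" "admissible (\<omega> [])" "enat j < NN (\<omega> [])"
    by (auto simp: in_tree_Cons)
  then show ?case by (simp add: path_weight_Cons admissible_def)
qed (simp add: admissible_def)

text \<open>The separate bound on \<open>a\<close> covers an empty \<open>I\<close>, where the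
  supremum is 0 and the sum is \<open>a\<close>.\<close>

lemma add_SUP_le_ennreal:
  fixes a S :: ennreal
  assumes "a \<le> S" "\<And>i. i \<in> I \<Longrightarrow> a + f i \<le> S"
  shows "a + (SUP i\<in>I. f i) \<le> S"
proof (cases "I = {}")
  case False
  then have "a + (SUP i\<in>I. f i) = (SUP i\<in>I. a + f i)"
    by (rule ennreal_SUP_add_right)
  then show ?thesis using assms by (simp add: SUP_least)
qed (use assms in \<open>simp add: bot_ennreal\<close>)

lemma enat_Suc_less_eSuc: "enat (Suc k) < eSuc n \<longleftrightarrow> enat k < n"
  using eSuc_mono[of "enat k" n] by (simp only: eSuc_enat)

text \<open>A path is either the root alone or a first edge followed by a path in the subtree of a
  child, and in \<open>ennreal\<close> multiplication by a constant commutes with suprema.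
  Admissibility makes path weights nonnegative, so that \<open>ennreal\<close> respects the sum and
  the product. At \<open>n = \<infinity>\<close> the two depths coincide and this is the recursion
  for the full tree sum.\<close>

lemma depth_sum_eSuc:
  assumes g: "\<forall>v. admissible (\<omega> v)"
  shows "depth_sum (eSuc n) \<omega>
    = ennreal (eta (\<omega> [])) + (SUP j. ennreal (wgt (\<omega> []) j) * depth_sum n (\<lambda>v. \<omega> (j # v)))"
proof (rule antisym)
  have pw: "ennreal (path_weight \<omega> (j # w))
      = ennreal (eta (\<omega> [])) + ennreal (wgt (\<omega> []) j) * ennreal (path_weight (\<lambda>v. \<omega> (j # v)) w)"
    if "in_tree \<omega> (j # w)" for j w
    using that g path_weight_nonneg[of "\<lambda>v. \<omega> (j # v)" w] wgt_eq_xi[of "\<omega> []" j]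
    by (auto simp: in_tree_Cons path_weight_Cons admissible_def ennreal_mult)
  show "depth_sum (eSuc n) \<omega>
    \<le> ennreal (eta (\<omega> [])) + (SUP j. ennreal (wgt (\<omega> []) j) * depth_sum n (\<lambda>v. \<omega> (j # v)))"
    unfolding depth_sum_def[of "eSuc n"]
  proof (rule SUP_least)
    fix v assume v: "v \<in> {v. in_tree \<omega> v \<and> enat (length v) < eSuc n}"
    show "ennreal (path_weight \<omega> v) \<le> ennreal (eta (\<omega> []))
        + (SUP j. ennreal (wgt (\<omega> []) j) * depth_sum n (\<lambda>v. \<omega> (j # v)))"
    proof (cases v)
      case (Cons j w)
      then have "in_tree \<omega> (j # w)" "in_tree (\<lambda>v. \<omega> (j # v)) w" "enat (length w) < n"
        using v enat_Suc_less_eSuc[of "length w" n] by (auto simp: in_tree_Cons)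
      then show ?thesis
        by (auto simp: Cons pw depth_sum_def
            intro!: add_left_mono SUP_upper2[of j] mult_left_mono SUP_upper)
    qed simp
  qed
  show "ennreal (eta (\<omega> [])) + (SUP j. ennreal (wgt (\<omega> []) j) * depth_sum n (\<lambda>v. \<omega> (j # v)))
    \<le> depth_sum (eSuc n) \<omega>"
  proof (rule add_SUP_le_ennreal)
    show eta: "ennreal (eta (\<omega> [])) \<le> depth_sum (eSuc n) \<omega>"
      unfolding depth_sum_def by (rule SUP_upper2[of "[]"]) (auto simp flip: zero_enat_def)
    fix j
    show "ennreal (eta (\<omega> [])) + ennreal (wgt (\<omega> []) j) * depth_sum n (\<lambda>v. \<omega> (j # v))
        \<le> depth_sum (eSuc n) \<omega>"
    proof (cases "enat j < NN (\<omega> [])")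
      case True
      \<comment> \<open>The set of paths in the subtree is empty for \<open>n = 0\<close>; the bound
        \<open>eta\<close> then settles the claim.\<close>
      show ?thesis
        unfolding depth_sum_def[of n] SUP_mult_left_ennreal
      proof (rule add_SUP_le_ennreal[OF eta])
        fix w assume "w \<in> {v. in_tree (\<lambda>v. \<omega> (j # v)) v \<and> enat (length v) < n}"
        then have w: "in_tree \<omega> (j # w)" "enat (length (j # w)) < eSuc n"
          using True enat_Suc_less_eSuc[of "length w" n] by (auto simp: in_tree_Cons)
        show "ennreal (eta (\<omega> [])) + ennreal (wgt (\<omega> []) j) * ennreal (path_weight (\<lambda>v. \<omega> (j # v)) w)
            \<le> depth_sum (eSuc n) \<omega>"
          unfolding pw[OF w(1), symmetric] depth_sum_def using w by (intro SUP_upper) auto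
      qed
    qed (use eta in \<open>simp add: wgt_def\<close>)
  qed
qed

text \<open>The strict inequality in the depth cutoff excludes even the root here. So depth 0 has
  the law \<delta> at 0, and depth \<open>n\<close> matches exactly \<open>n\<close> applications of
  the map.\<close>

lemma depth_sum_0 [simp]: "depth_sum 0 \<omega> = 0"
  by (simp add: depth_sum_def bot_ennreal)

lemma depth_sum_infinity: "depth_sum \<infinity> = tree_sum"
  by (simp add: depth_sum_def tree_sum_def fun_eq_iff)

lemma incseq_depth_sum: "incseq (\<lambda>n. depth_sum (enat n) \<omega>)"
  unfolding depth_sum_def
  by (intro incseq_SucI SUP_subset_mono) auto

lemma tree_sum_eq_SUP: "tree_sum \<omega> = (SUP n. depth_sum (enat n) \<omega>)"
proof (rule antisym)
  show "tree_sum \<omega> \<le> (SUP n. depth_sum (enat n) \<omega>)"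
    unfolding tree_sum_def
  proof (rule SUP_least)
    fix v assume "v \<in> {v. in_tree \<omega> v}"
    then show "ennreal (path_weight \<omega> v) \<le> (SUP n. depth_sum (enat n) \<omega>)"
      by (intro SUP_upper2[of "Suc (length v)"]) (auto simp: depth_sum_def intro: SUP_upper)
  qed
  show "(SUP n. depth_sum (enat n) \<omega>) \<le> tree_sum \<omega>"
    unfolding tree_sum_def depth_sum_def by (intro SUP_least SUP_subset_mono) auto
qed

section \<open>Measurability, and how c(p) enters\<close>

lemma measurable_Dspace [measurable]:
  "eta \<in> borel_measurable Dspace" "(\<lambda>d. xi d j) \<in> borel_measurable Dspace"
  "NN \<in> measurable Dspace (count_space UNIV)"
  unfolding eta_def[abs_def] xi_def[abs_def] NN_def[abs_def] Dspace_def by measurable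

lemma space_Dspace [simp]: "space Dspace = UNIV"
  by (simp add: Dspace_def space_pair_measure space_PiM)

locale rde = prob_space D for D :: "dat measure" +
  assumes sets_D [measurable_cong]: "sets D = sets Dspace"
    and AE_admissible: "AE d in D. admissible d"
begin

lemma space_D [simp]: "space D = UNIV"
  using sets_eq_imp_space_eq[OF sets_D] by simp

lemma measurable_wgt [measurable]: "(\<lambda>d. wgt d j) \<in> borel_measurable D"
  unfolding wgt_def by measurable

text \<open>The set of available paths depends on \<open>\<omega>\<close>. Giving the other words
  the value 0 turns the expression into a supremum over all words, which are countably many.\<close>

lemma measurable_depth_sum [measurable]: "depth_sum n \<in> borel_measurable (tree_space D)"
proof -
  have "(\<lambda>\<omega>. SUP v. if in_tree \<omega> v \<and> enat (length v) < n then ennreal (path_weight \<omega> v) else 0)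
      \<in> borel_measurable (tree_space D)"
    unfolding in_tree_def path_weight_def tree_space_def by measurable
  also have "(\<lambda>\<omega>. SUP v. if in_tree \<omega> v \<and> enat (length v) < n then ennreal (path_weight \<omega> v) else 0)
      = depth_sum n"
  proof (rule ext, rule antisym)
    fix \<omega>
    show "(SUP v. if in_tree \<omega> v \<and> enat (length v) < n then ennreal (path_weight \<omega> v) else 0)
        \<le> depth_sum n \<omega>"
      unfolding depth_sum_def by (rule SUP_least) (auto intro: SUP_upper)
    show "depth_sum n \<omega>
        \<le> (SUP v. if in_tree \<omega> v \<and> enat (length v) < n then ennreal (path_weight \<omega> v) else 0)"
      unfolding depth_sum_def by (rule SUP_mono) auto
  qed
  finally show ?thesis .
qed

lemma measurable_tree_sum [measurable]: "tree_sum \<in> borel_measurable (tree_space D)"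
  using measurable_depth_sum[of \<infinity>] by (simp add: depth_sum_infinity)

lemma measurable_rde_sup [measurable]:
  assumes [measurable_cong]: "sets \<mu> = sets borel"
  shows "(\<lambda>z. rde_sup (fst z) (snd z)) \<in> borel_measurable (D \<Otimes>\<^sub>M (\<Pi>\<^sub>M j\<in>(UNIV::nat set). \<mu>))"
  unfolding rde_sup_eq_wgt by measurable

lemma cfun_eq_wgt: "cfun D p = (\<Sum>j. \<integral>\<^sup>+ d. ennreal (wgt d j powr p) \<partial>D)"
  unfolding cfun_def
  by (intro arg_cong[where f=suminf] ext nn_integral_cong_AE)
    (use AE_admissible in \<open>auto simp: wgt_def admissible_def\<close>)

text \<open>Tonelli, with the data independent of the i.i.d. family. It is used with
  \<open>h\<close> the absolute value to bound moments, and with \<open>h\<close> the distance of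
  the two coordinates of a coupling to obtain the contraction.\<close>

lemma nn_integral_wgt_powr:
  assumes "prob_space \<pi>" and h [measurable]: "h \<in> borel_measurable \<pi>" and "\<And>x. 0 \<le> h x"
  shows "(\<integral>\<^sup>+ z. (\<Sum>j. ennreal ((wgt (fst z) j * h (snd z j)) powr p)) \<partial>(D \<Otimes>\<^sub>M (\<Pi>\<^sub>M j\<in>(UNIV::nat set). \<pi>)))
    = cfun D p * (\<integral>\<^sup>+ x. ennreal (h x powr p) \<partial>\<pi>)"
proof -
  let ?F = "\<Pi>\<^sub>M j\<in>(UNIV::nat set). \<pi>"
  interpret F: prob_space ?F by (rule prob_PiM_UNIV) fact
  have [measurable]: "(\<lambda>f. h (f j)) \<in> borel_measurable ?F" for j :: nat by measurable
  have comp: "(\<integral>\<^sup>+ f. ennreal (h (f j) powr p) \<partial>?F) = (\<integral>\<^sup>+ x. ennreal (h x powr p) \<partial>\<pi>)" for j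
  proof -
    have "(\<integral>\<^sup>+ x. ennreal (h x powr p) \<partial>\<pi>)
        = (\<integral>\<^sup>+ x. ennreal (h x powr p) \<partial>distr ?F \<pi> (\<lambda>f. f j))"
      using assms(1) by (subst distr_PiM_component) auto
    also have "\<dots> = (\<integral>\<^sup>+ f. ennreal (h (f j) powr p) \<partial>?F)"
      by (rule nn_integral_distr) measurable
    finally show ?thesis by simp
  qed
  have "(\<integral>\<^sup>+ z. (\<Sum>j. ennreal ((wgt (fst z) j * h (snd z j)) powr p)) \<partial>(D \<Otimes>\<^sub>M ?F))
      = (\<Sum>j. \<integral>\<^sup>+ z. ennreal (wgt (fst z) j powr p) * ennreal (h (snd z j) powr p) \<partial>(D \<Otimes>\<^sub>M ?F))"
    using assms(3) by (subst nn_integral_suminf) (auto simp: powr_mult ennreal_mult)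
  also have "\<dots> = (\<Sum>j. (\<integral>\<^sup>+ d. ennreal (wgt d j powr p) \<partial>D) * (\<integral>\<^sup>+ x. ennreal (h x powr p) \<partial>\<pi>))"
  proof (intro arg_cong[where f=suminf] ext)
    fix j
    have "(\<integral>\<^sup>+ z. ennreal (wgt (fst z) j powr p) * ennreal (h (snd z j) powr p) \<partial>(D \<Otimes>\<^sub>M ?F))
        = (\<integral>\<^sup>+ d. \<integral>\<^sup>+ f. ennreal (wgt d j powr p) * ennreal (h (f j) powr p) \<partial>?F \<partial>D)"
      by (subst F.nn_integral_fst[symmetric]) simp_all
    then show "(\<integral>\<^sup>+ z. ennreal (wgt (fst z) j powr p) * ennreal (h (snd z j) powr p) \<partial>(D \<Otimes>\<^sub>M ?F))
        = (\<integral>\<^sup>+ d. ennreal (wgt d j powr p) \<partial>D) * (\<integral>\<^sup>+ x. ennreal (h x powr p) \<partial>\<pi>)"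
      by (simp add: nn_integral_cmult nn_integral_multc comp)
  qed
  finally show ?thesis by (simp add: cfun_eq_wgt)
qed

end

section \<open>Laws of the truncated tree sums\<close>

lemma distr_pair_snd:
  assumes "prob_space M" "sigma_finite_measure N"
  shows "distr (M \<Otimes>\<^sub>M N) N snd = N"
proof (rule measure_eqI)
  interpret M: prob_space M by fact
  interpret N: sigma_finite_measure N by fact
  fix A assume "A \<in> sets (distr (M \<Otimes>\<^sub>M N) N snd)"
  then have A: "A \<in> sets N" by simp
  have "snd -` A \<inter> space (M \<Otimes>\<^sub>M N) = space M \<times> A"
    using sets.sets_into_space[OF A] by (auto simp: space_pair_measure)
  then show "emeasure (distr (M \<Otimes>\<^sub>M N) N snd) A = emeasure N A"
    using A by (simp add: emeasure_distr N.emeasure_pair_measure_Times M.emeasure_space_1)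
qed simp

lemma AE_pair_fst:
  assumes "prob_space N" "AE x in M. P x"
  shows "AE z in M \<Otimes>\<^sub>M N. P (fst z)"
  using assms(2) AE_distrD[OF measurable_fst, of P M N]
  unfolding prob_space.distr_pair_fst[OF assms(1)] by simp

lemma AE_pair_snd:
  assumes "prob_space M" "prob_space N" "AE x in N. P x"
  shows "AE z in M \<Otimes>\<^sub>M N. P (snd z)"
  using assms(3) AE_distrD[OF measurable_snd, of P M N]
  unfolding distr_pair_snd[OF assms(1) prob_space_imp_sigma_finite[OF assms(2)]] by simp

lemma term_le_suminf_ennreal: "f j \<le> (\<Sum>j. f j :: ennreal)"
  using sum_le_suminf[OF summableI, of "{j}" f] by simp

lemma Fp_real_distribution: "Fp p \<mu> \<Longrightarrow> real_distribution \<mu>"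
  by (simp add: Fp_def)

lemma Fp_sets: "Fp p \<mu> \<Longrightarrow> sets \<mu> = sets borel"
  by (simp add: Fp_def real_distribution_def real_distribution_axioms_def)

context rde
begin

section \<open>Realisations of T and its effect on moments\<close>

lemma AE_admissible_nonneg:
  assumes "prob_space \<mu>" "AE x in \<mu>. 0 \<le> (x::real)"
  shows "AE z in D \<Otimes>\<^sub>M (\<Pi>\<^sub>M j\<in>(UNIV::nat set). \<mu>). admissible (fst z) \<and> (\<forall>j. 0 \<le> snd z j)"
proof -
  have "AE f in (\<Pi>\<^sub>M j\<in>(UNIV::nat set). \<mu>). \<forall>j. 0 \<le> f j"
    unfolding AE_all_countable using AE_PiM_UNIV[OF assms] by blast
  from AE_pair_snd[OF prob_space_axioms prob_PiM_UNIV[OF assms(1)] this]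
    AE_pair_fst[OF prob_PiM_UNIV[OF assms(1)] AE_admissible]
  show ?thesis by eventually_elim simp
qed

lemma distr_pair_PiM:
  assumes "prob_space \<pi>" and g: "g \<in> borel_measurable \<pi>"
  shows "distr (D \<Otimes>\<^sub>M (\<Pi>\<^sub>M j\<in>(UNIV::nat set). \<pi>)) (D \<Otimes>\<^sub>M (\<Pi>\<^sub>M j\<in>(UNIV::nat set). borel))
      (\<lambda>z. (fst z, \<lambda>j. g (snd z j)))
    = D \<Otimes>\<^sub>M (\<Pi>\<^sub>M j\<in>(UNIV::nat set). distr \<pi> borel g)"
    and "(\<lambda>z. (fst z, \<lambda>j. g (snd z j))) \<in> measurable (D \<Otimes>\<^sub>M (\<Pi>\<^sub>M j\<in>(UNIV::nat set). \<pi>))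
      (D \<Otimes>\<^sub>M (\<Pi>\<^sub>M j\<in>(UNIV::nat set). borel))"
proof -
  let ?F = "\<Pi>\<^sub>M j\<in>(UNIV::nat set). \<pi>"
  let ?G = "\<Pi>\<^sub>M j\<in>(UNIV::nat set). (borel :: 'b measure)"
  interpret F: prob_space ?F by (rule prob_PiM_UNIV) fact
  have m: "(\<lambda>f j. g (f j)) \<in> measurable ?F ?G"
  proof (rule measurable_PiM_single')
    show "(\<lambda>f. g (f j)) \<in> measurable ?F borel" for j
      by (rule measurable_compose[OF measurable_component_singleton[of j UNIV "\<lambda>_. \<pi>"] g]) simp
  qed (simp add: space_PiM)
  have eq: "distr ?F ?G (\<lambda>f j. g (f j)) = (\<Pi>\<^sub>M j\<in>UNIV. distr \<pi> borel g)"
    by (rule distr_PiM_map) fact+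
  have "D \<Otimes>\<^sub>M (\<Pi>\<^sub>M j\<in>(UNIV::nat set). distr \<pi> borel g) = distr D D (\<lambda>d. d) \<Otimes>\<^sub>M distr ?F ?G (\<lambda>f j. g (f j))"
    unfolding eq by (simp add: distr_id2)
  also have "\<dots> = distr (D \<Otimes>\<^sub>M ?F) (D \<Otimes>\<^sub>M ?G) (\<lambda>(d, f). (d, \<lambda>j. g (f j)))"
    using F.prob_space_distr[OF m] m
    by (intro pair_measure_distr) (auto intro: prob_space_imp_sigma_finite)
  finally show "distr (D \<Otimes>\<^sub>M ?F) (D \<Otimes>\<^sub>M ?G) (\<lambda>z. (fst z, \<lambda>j. g (snd z j)))
    = D \<Otimes>\<^sub>M (\<Pi>\<^sub>M j\<in>(UNIV::nat set). distr \<pi> borel g)"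
    by (simp add: case_prod_unfold)
  show "(\<lambda>z. (fst z, \<lambda>j. g (snd z j))) \<in> measurable (D \<Otimes>\<^sub>M ?F) (D \<Otimes>\<^sub>M ?G)"
    using measurable_compose[OF measurable_snd m] by (intro measurable_Pair) auto
qed

lemma AE_pair_PiM_distr:
  assumes "prob_space \<pi>" "g \<in> borel_measurable \<pi>"
    and "AE z in D \<Otimes>\<^sub>M (\<Pi>\<^sub>M j\<in>(UNIV::nat set). distr \<pi> borel g). P (fst z) (snd z)"
  shows "AE z in D \<Otimes>\<^sub>M (\<Pi>\<^sub>M j\<in>(UNIV::nat set). \<pi>). P (fst z) (\<lambda>j. g (snd z j))"
  using AE_distrD[OF distr_pair_PiM(2)[OF assms(1,2)], of "\<lambda>z. P (fst z) (snd z)"] assms(3)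
  unfolding distr_pair_PiM(1)[OF assms(1,2)] by simp

lemma measurable_rde_sup_compose:
  assumes "prob_space \<pi>" "g \<in> borel_measurable \<pi>"
  shows "(\<lambda>z. rde_sup (fst z) (\<lambda>j. g (snd z j))) \<in> borel_measurable (D \<Otimes>\<^sub>M (\<Pi>\<^sub>M j\<in>(UNIV::nat set). \<pi>))"
  using measurable_compose[OF distr_pair_PiM(2)[OF assms] measurable_rde_sup[OF refl]] by simp

text \<open>It serves two purposes. With \<open>\<pi>\<close> the tree space and \<open>g\<close> a
  truncated sum, it identifies grafting with the map T; with \<open>\<pi>\<close> a coupling and
  \<open>g\<close> a projection, it places the images of both marginals on one probability
  space.\<close>

lemma Tmap_distr:
  assumes "prob_space \<pi>" "g \<in> borel_measurable \<pi>"
  shows "Tmap D (distr \<pi> borel g) = distr (D \<Otimes>\<^sub>M (\<Pi>\<^sub>M j\<in>(UNIV::nat set). \<pi>)) borel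
    (\<lambda>z. enn2real (rde_sup (fst z) (\<lambda>j. g (snd z j))))"
  unfolding Tmap_def distr_pair_PiM(1)[OF assms, symmetric]
  using measurable_compose[OF measurable_rde_sup[OF refl] borel_measurable_enn2real[OF measurable_ident]]
  by (subst distr_distr) (auto intro: distr_pair_PiM(2)[OF assms] simp: comp_def)

lemma real_distribution_Tmap:
  assumes "real_distribution \<mu>"
  shows "real_distribution (Tmap D \<mu>)"
proof -
  interpret \<mu>: real_distribution \<mu> by fact
  have "prob_space (D \<Otimes>\<^sub>M (\<Pi>\<^sub>M j\<in>(UNIV::nat set). \<mu>))"
    by (intro prob_space_pair prob_PiM_UNIV prob_space_axioms \<mu>.prob_space_axioms)
  then show ?thesis
    unfolding Tmap_def by (rule prob_space.real_distribution_distr) simp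
qed

lemma rde_sup_moment:
  assumes "Fp p \<mu>" "1 \<le> p" "cfun D p < \<infinity>"
  shows "AE z in D \<Otimes>\<^sub>M (\<Pi>\<^sub>M j\<in>(UNIV::nat set). \<mu>). rde_sup (fst z) (snd z) < \<infinity>"
    and "0 < l \<Longrightarrow> l < 1 \<Longrightarrow> (\<integral>\<^sup>+ x. ennreal (\<bar>x\<bar> powr p) \<partial>Tmap D \<mu>)
      \<le> ennreal (l powr (1 - p)) * (\<integral>\<^sup>+ d. ennreal (eta d powr p) \<partial>D)
        + ennreal ((1 - l) powr (1 - p)) * (cfun D p * (\<integral>\<^sup>+ x. ennreal (\<bar>x\<bar> powr p) \<partial>\<mu>))"
proof -
  let ?F = "\<Pi>\<^sub>M j\<in>(UNIV::nat set). \<mu>"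
  interpret \<mu>: real_distribution \<mu> using assms(1) by (rule Fp_real_distribution)
  interpret F: prob_space ?F by (rule prob_PiM_UNIV) (rule \<mu>.prob_space_axioms)
  have p: "0 < p" using \<open>1 \<le> p\<close> by simp
  \<comment> \<open>This sum dominates the p-th power of the supremum, and its mean is c(p) times
    the p-th moment of \<open>\<mu>\<close>. A finite mean makes it, and hence the supremum, finite
    almost surely.\<close>
  define s where "s z = (\<Sum>j. ennreal ((wgt (fst z) j * \<bar>snd z j\<bar>) powr p))"
    for z :: "dat \<times> (nat \<Rightarrow> real)"
  have [measurable]: "s \<in> borel_measurable (D \<Otimes>\<^sub>M ?F)"
    unfolding s_def by measurable
  have int_s: "(\<integral>\<^sup>+ z. s z \<partial>(D \<Otimes>\<^sub>M ?F)) = cfun D p * (\<integral>\<^sup>+ x. ennreal (\<bar>x\<bar> powr p) \<partial>\<mu>)"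
    unfolding s_def by (rule nn_integral_wgt_powr) (auto intro: \<mu>.prob_space_axioms)
  also have "\<dots> < \<infinity>" using assms by (simp add: Fp_def ennreal_mult_less_top)
  finally have fin_s: "AE z in D \<Otimes>\<^sub>M ?F. s z < \<infinity>"
    using nn_integral_PInf_AE[of s "D \<Otimes>\<^sub>M ?F"] by (simp add: less_top)
  have nn: "AE z in D \<Otimes>\<^sub>M ?F. admissible (fst z) \<and> (\<forall>j. 0 \<le> snd z j)"
    using AE_admissible_nonneg[OF \<mu>.prob_space_axioms] assms(1) by (simp add: Fp_def)
  have term_le: "ennreal ((wgt (fst z) j * \<bar>snd z j\<bar>) powr p) \<le> s z" for z j
    unfolding s_def by (rule term_le_suminf_ennreal)
  let ?S = "\<lambda>z. (SUP j. ennreal (wgt (fst z) j * \<bar>snd z j\<bar>))"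
  have S: "ennreal (enn2real (?S z) powr p) \<le> s z" "s z < \<infinity> \<Longrightarrow> ?S z < \<infinity>" for z
    by (rule powr_SUP_le; use term_le p in simp)+
  have rde: "rde_sup (fst z) (snd z) = ennreal (eta (fst z)) + ?S z" if "\<forall>j. 0 \<le> snd z j" for z
    using that by (simp add: rde_sup_eq_wgt ennreal_mult)
  show "AE z in D \<Otimes>\<^sub>M ?F. rde_sup (fst z) (snd z) < \<infinity>"
    using fin_s nn
  proof eventually_elim
    case (elim z)
    then have "rde_sup (fst z) (snd z) = ennreal (eta (fst z)) + ?S z" "?S z < \<infinity>"
      using rde[of z] S(2)[of z] by blast+
    then show ?case by (simp only: ennreal_add_less_top infinity_ennreal_def) simp
  qed
  assume l: "0 < l" "l < 1"
  let ?R = "\<lambda>z. enn2real (rde_sup (fst z) (snd z))"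
  have [measurable]: "?R \<in> borel_measurable (D \<Otimes>\<^sub>M ?F)" by measurable
  have "(\<integral>\<^sup>+ x. ennreal (\<bar>x\<bar> powr p) \<partial>Tmap D \<mu>) = (\<integral>\<^sup>+ z. ennreal (\<bar>?R z\<bar> powr p) \<partial>(D \<Otimes>\<^sub>M ?F))"
    unfolding Tmap_def by (rule nn_integral_distr) measurable
  also have "\<dots> \<le> (\<integral>\<^sup>+ z. ennreal (l powr (1 - p)) * ennreal (eta (fst z) powr p)
        + ennreal ((1 - l) powr (1 - p)) * s z \<partial>(D \<Otimes>\<^sub>M ?F))"
  proof (rule nn_integral_mono_AE)
    show "AE z in D \<Otimes>\<^sub>M ?F. ennreal (\<bar>?R z\<bar> powr p)
      \<le> ennreal (l powr (1 - p)) * ennreal (eta (fst z) powr p) + ennreal ((1 - l) powr (1 - p)) * s z"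
      using fin_s nn
    proof eventually_elim
      case (elim z)
      then have e: "0 \<le> eta (fst z)" by (simp add: admissible_def)
      have "?R z = eta (fst z) + enn2real (?S z)"
        using e elim S(2)[of z] rde[of z] by (metis enn2real_ennreal enn2real_plus ennreal_less_top infinity_ennreal_def)
      then have "\<bar>?R z\<bar> powr p
          \<le> l powr (1 - p) * eta (fst z) powr p + (1 - l) powr (1 - p) * enn2real (?S z) powr p"
        using powr_add_le_weighted[of "eta (fst z)" "enn2real (?S z)" l p] e l \<open>1 \<le> p\<close> by simp
      then have "ennreal (\<bar>?R z\<bar> powr p) \<le> ennreal (l powr (1 - p)) * ennreal (eta (fst z) powr p)
          + ennreal ((1 - l) powr (1 - p)) * ennreal (enn2real (?S z) powr p)"
        by (simp add: ennreal_leI flip: ennreal_mult ennreal_plus)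
      also have "\<dots> \<le> ennreal (l powr (1 - p)) * ennreal (eta (fst z) powr p)
          + ennreal ((1 - l) powr (1 - p)) * s z"
        by (intro add_left_mono mult_left_mono S(1)) simp
      finally show ?case .
    qed
  qed
  also have "\<dots> = ennreal (l powr (1 - p)) * (\<integral>\<^sup>+ z. ennreal (eta (fst z) powr p) \<partial>(D \<Otimes>\<^sub>M ?F))
        + ennreal ((1 - l) powr (1 - p)) * (\<integral>\<^sup>+ z. s z \<partial>(D \<Otimes>\<^sub>M ?F))"
    by (simp add: nn_integral_add nn_integral_cmult)
  also have "(\<integral>\<^sup>+ z. ennreal (eta (fst z) powr p) \<partial>(D \<Otimes>\<^sub>M ?F)) = (\<integral>\<^sup>+ d. ennreal (eta d powr p) \<partial>D)"
    by (subst F.nn_integral_fst[symmetric]) (simp_all add: F.emeasure_space_1)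
  finally show "(\<integral>\<^sup>+ x. ennreal (\<bar>x\<bar> powr p) \<partial>Tmap D \<mu>)
      \<le> ennreal (l powr (1 - p)) * (\<integral>\<^sup>+ d. ennreal (eta d powr p) \<partial>D)
        + ennreal ((1 - l) powr (1 - p)) * (cfun D p * (\<integral>\<^sup>+ x. ennreal (\<bar>x\<bar> powr p) \<partial>\<mu>))"
    by (simp add: int_s)
qed

lemma AE_Tmap_nonneg:
  assumes "sets \<mu> = sets borel"
  shows "AE x in Tmap D \<mu>. 0 \<le> x"
  unfolding Tmap_def using measurable_rde_sup[OF assms]
  by (subst AE_distr_iff) auto

lemma Fp_Tmap:
  assumes "Fp p \<mu>" "1 \<le> p" "cfun D p < \<infinity>" "(\<integral>\<^sup>+ d. ennreal (eta d powr p) \<partial>D) < \<infinity>"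
  shows "Fp p (Tmap D \<mu>)"
proof -
  \<comment> \<open>Only finiteness is at stake, so any \<open>l\<close> in (0, 1) would do; 1/2 is
    chosen.\<close>
  have "ennreal ((1/2) powr (1 - p)) * (\<integral>\<^sup>+ d. ennreal (eta d powr p) \<partial>D)
        + ennreal ((1 - 1/2) powr (1 - p)) * (cfun D p * (\<integral>\<^sup>+ x. ennreal (\<bar>x\<bar> powr p) \<partial>\<mu>)) < \<infinity>"
    using assms by (simp add: Fp_def ennreal_mult_less_top)
  from le_less_trans[OF rde_sup_moment(2)[OF assms(1-3)] this]
  have "(\<integral>\<^sup>+ x. ennreal (\<bar>x\<bar> powr p) \<partial>Tmap D \<mu>) < \<infinity>" by simp
  then show ?thesis
    unfolding Fp_def
    using AE_Tmap_nonneg[OF Fp_sets[OF assms(1)]]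
      real_distribution_Tmap[OF Fp_real_distribution[OF assms(1)]] by blast
qed

section \<open>Truncated tree sums as iterates of T\<close>

lemma prob_tree_space: "prob_space (tree_space D)"
  unfolding tree_space_def by (rule prob_PiM_UNIV) (rule prob_space_axioms)

lemma distr_graft_tree_space:
  "distr (D \<Otimes>\<^sub>M (\<Pi>\<^sub>M j\<in>(UNIV::nat set). tree_space D)) (tree_space D) graft = tree_space D"
  and measurable_graft_tree_space [measurable]:
  "graft \<in> measurable (D \<Otimes>\<^sub>M (\<Pi>\<^sub>M j\<in>(UNIV::nat set). tree_space D)) (tree_space D)"
  unfolding tree_space_def by (rule distr_graft[OF prob_space_axioms] measurable_graft)+

lemma AE_tree_admissible: "AE \<omega> in tree_space D. \<forall>v. admissible (\<omega> v)"
  unfolding AE_all_countable tree_space_def using AE_PiM_UNIV[OF prob_space_axioms AE_admissible] by blast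

definition depth_law :: "enat \<Rightarrow> real measure" where
  "depth_law n = distr (tree_space D) borel (\<lambda>\<omega>. enn2real (depth_sum n \<omega>))"

lemma depth_law_0: "depth_law 0 = return borel 0"
proof (rule measure_eqI)
  interpret T: prob_space "tree_space D" by (rule prob_tree_space)
  fix A assume "A \<in> sets (depth_law 0)"
  then show "emeasure (depth_law 0) A = emeasure (return borel 0) A"
    by (auto simp: depth_law_def emeasure_distr T.emeasure_space_1 indicator_def)
qed (simp add: depth_law_def)

text \<open>The tree law is pulled back along \<open>graft\<close>, where the pathwise recursion
  becomes the one defining T. Finiteness of the subtree sums is required because \<open>Tmap\<close>
  feeds on their \<open>enn2real\<close>, which would replace an infinite value by 0. The second
  claim hands finiteness on to the next depth.\<close>

lemma depth_law_eSuc: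
  assumes fin: "AE \<omega> in tree_space D. depth_sum n \<omega> < \<infinity>"
  shows "depth_law (eSuc n) = Tmap D (depth_law n)"
    and "(AE z in D \<Otimes>\<^sub>M (\<Pi>\<^sub>M j\<in>(UNIV::nat set). depth_law n). rde_sup (fst z) (snd z) < \<infinity>)
      \<Longrightarrow> AE \<omega> in tree_space D. depth_sum (eSuc n) \<omega> < \<infinity>"
proof -
  let ?P = "D \<Otimes>\<^sub>M (\<Pi>\<^sub>M j\<in>(UNIV::nat set). tree_space D)"
  let ?g = "\<lambda>\<omega>. enn2real (depth_sum n \<omega>)"
  interpret T: prob_space "tree_space D" by (rule prob_tree_space)
  have "AE z in ?P. \<forall>v. admissible (graft z v)"
    using AE_distrD[OF measurable_graft_tree_space, of "\<lambda>\<omega>. \<forall>v. admissible (\<omega> v)"] AE_tree_admissible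
    unfolding distr_graft_tree_space by simp
  moreover have "AE z in ?P. \<forall>j. depth_sum n (snd z j) < \<infinity>"
  proof (rule AE_pair_snd[OF prob_space_axioms prob_PiM_UNIV[OF prob_tree_space]])
    show "AE f in (\<Pi>\<^sub>M j\<in>(UNIV::nat set). tree_space D). \<forall>j. depth_sum n (f j) < \<infinity>"
      unfolding AE_all_countable using AE_PiM_UNIV[OF prob_tree_space fin] by blast
  qed
  ultimately have eq: "AE z in ?P. depth_sum (eSuc n) (graft z) = rde_sup (fst z) (\<lambda>j. ?g (snd z j))"
  proof eventually_elim
    case (elim z)
    have "graft z [] = fst z" "(\<lambda>v. graft z (j # v)) = snd z j" for j
      by (auto simp: graft_def)
    then show ?case
      using elim by (simp add: depth_sum_eSuc rde_sup_eq_wgt)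
  qed
  have m: "(\<lambda>z. rde_sup (fst z) (\<lambda>j. ?g (snd z j))) \<in> borel_measurable ?P"
    by (rule measurable_rde_sup_compose[OF prob_tree_space]) measurable
  have "depth_law (eSuc n) = distr (distr ?P (tree_space D) graft) borel (\<lambda>\<omega>. enn2real (depth_sum (eSuc n) \<omega>))"
    by (simp add: depth_law_def distr_graft_tree_space)
  also have "\<dots> = distr ?P borel (\<lambda>z. enn2real (depth_sum (eSuc n) (graft z)))"
    by (subst distr_distr) (auto simp: comp_def)
  also have "\<dots> = distr ?P borel (\<lambda>z. enn2real (rde_sup (fst z) (\<lambda>j. ?g (snd z j))))"
    using m eq by (intro distr_cong_AE) auto
  also have "\<dots> = Tmap D (depth_law n)"
    unfolding depth_law_def by (rule Tmap_distr[OF prob_tree_space, symmetric]) measurable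
  finally show "depth_law (eSuc n) = Tmap D (depth_law n)" .
  assume "AE z in D \<Otimes>\<^sub>M (\<Pi>\<^sub>M j\<in>(UNIV::nat set). depth_law n). rde_sup (fst z) (snd z) < \<infinity>"
  then have "AE z in ?P. rde_sup (fst z) (\<lambda>j. ?g (snd z j)) < \<infinity>"
    unfolding depth_law_def by (intro AE_pair_PiM_distr[OF prob_tree_space]) auto
  then have "AE z in ?P. depth_sum (eSuc n) (graft z) < \<infinity>"
    using eq by eventually_elim simp
  then have "AE \<omega> in distr ?P (tree_space D) graft. depth_sum (eSuc n) \<omega> < \<infinity>"
    by (subst AE_distr_iff) auto
  then show "AE \<omega> in tree_space D. depth_sum (eSuc n) \<omega> < \<infinity>"
    unfolding distr_graft_tree_space .
qed

lemma Fp_return_0: "Fp p (return borel 0)"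
proof -
  interpret R: prob_space "return borel (0::real)" by (rule prob_space_return) simp
  show ?thesis
    by (simp add: Fp_def real_distribution_def real_distribution_axioms_def R.prob_space_axioms
        AE_return nn_integral_return)
qed

text \<open>The three claims need a joint induction: the law identity uses finiteness of the sum,
  finiteness one level deeper uses the p-th moment, and the moment passes on through the law
  identity.\<close>

lemma Tmap_iterates:
  assumes "1 \<le> p" "cfun D p < \<infinity>" "(\<integral>\<^sup>+ d. ennreal (eta d powr p) \<partial>D) < \<infinity>"
  shows "(Tmap D ^^ n) (return borel 0) = depth_law (enat n)"
    and "Fp p (depth_law (enat n))"
    and "AE \<omega> in tree_space D. depth_sum (enat n) \<omega> < \<infinity>"
proof -
  have "(Tmap D ^^ n) (return borel 0) = depth_law (enat n) \<and> Fp p (depth_law (enat n))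
    \<and> (AE \<omega> in tree_space D. depth_sum (enat n) \<omega> < \<infinity>)"
  proof (induction n)
    case 0
    then show ?case using depth_law_0 Fp_return_0 by (simp flip: zero_enat_def)
  next
    case (Suc n)
    then show ?case
      using depth_law_eSuc[of "enat n"] Fp_Tmap[OF _ assms] rde_sup_moment(1)[OF _ assms(1,2)]
      by (simp add: eSuc_enat)
  qed
  then show "(Tmap D ^^ n) (return borel 0) = depth_law (enat n)" "Fp p (depth_law (enat n))"
    "AE \<omega> in tree_space D. depth_sum (enat n) \<omega> < \<infinity>" by auto
qed

end

section \<open>Wasserstein contraction\<close>

lemma abs_diff_powr_le:
  fixes x y p :: real
  assumes "0 \<le> p"
  shows "\<bar>x - y\<bar> powr p \<le> 2 powr p * (\<bar>x\<bar> powr p + \<bar>y\<bar> powr p)"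
proof -
  have "\<bar>x - y\<bar> powr p \<le> (2 * max \<bar>x\<bar> \<bar>y\<bar>) powr p"
    using assms by (intro powr_mono2) auto
  also have "\<dots> = 2 powr p * max \<bar>x\<bar> \<bar>y\<bar> powr p"
    by (simp add: powr_mult)
  also have "max \<bar>x\<bar> \<bar>y\<bar> powr p \<le> \<bar>x\<bar> powr p + \<bar>y\<bar> powr p"
    by (auto simp: max_def)
  finally show ?thesis by simp
qed

text \<open>The common term \<open>eta d\<close> cancels, and a supremum moves by at most the
  largest movement of its terms. That largest movement is then bounded by the l^p sum. Finiteness
  permits passing from sums in \<open>ennreal\<close> to differences of reals.\<close>

lemma rde_sup_diff_powr_le:
  assumes p: "0 < p" and x: "\<And>j. 0 \<le> x j" and y: "\<And>j. 0 \<le> y j"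
    and fin: "rde_sup d x < \<infinity>" "rde_sup d y < \<infinity>"
  shows "ennreal (\<bar>enn2real (rde_sup d x) - enn2real (rde_sup d y)\<bar> powr p)
    \<le> (\<Sum>j. ennreal ((wgt d j * \<bar>x j - y j\<bar>) powr p))" (is "_ \<le> ?s")
proof (cases "?s < \<infinity>")
  case True
  let ?S = "SUP j. ennreal (wgt d j * \<bar>x j - y j\<bar>)"
  have le: "ennreal ((wgt d j * \<bar>x j - y j\<bar>) powr p) \<le> ?s" for j
    by (rule term_le_suminf_ennreal)
  have S: "ennreal (enn2real ?S powr p) \<le> ?s"
    by (rule powr_SUP_le(1)[OF p _ le]) simp
  have fin_S: "?S < \<infinity>"
    by (rule powr_SUP_le(2)[OF p _ le True]) simp
  \<comment> \<open>Stated for a general pair so that it applies to \<open>x\<close>,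
    \<open>y\<close> in either order.\<close>
  have tri: "rde_sup d u \<le> rde_sup d v + ?S"
    if u: "\<And>j. 0 \<le> u j" and v: "\<And>j. 0 \<le> v j" and uv: "\<And>j. \<bar>u j - v j\<bar> = \<bar>x j - y j\<bar>" for u v
    unfolding rde_sup_eq_wgt[of d u] rde_sup_eq_wgt[of d v] add.assoc
  proof (intro add_left_mono SUP_least)
    fix j
    have "u j \<le> v j + \<bar>x j - y j\<bar>" using uv[of j] by linarith
    then have "wgt d j * u j \<le> wgt d j * v j + wgt d j * \<bar>x j - y j\<bar>"
      using mult_left_mono[OF _ wgt_nonneg[of d j]] by (simp flip: distrib_left)
    then have "ennreal (wgt d j) * ennreal (u j)
        \<le> ennreal (wgt d j) * ennreal (v j) + ennreal (wgt d j * \<bar>x j - y j\<bar>)"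
      using u[of j] v[of j] by (simp flip: ennreal_mult ennreal_plus)
    also have "\<dots> \<le> (SUP j. ennreal (wgt d j) * ennreal (v j)) + ?S"
      by (intro add_mono SUP_upper) auto
    finally show "ennreal (wgt d j) * ennreal (u j)
        \<le> (SUP j. ennreal (wgt d j) * ennreal (v j)) + ?S" .
  qed
  have real: "enn2real a - enn2real b \<le> enn2real c" if "a \<le> b + c" "a < \<infinity>" "b < \<infinity>" "c < \<infinity>"
    for a b c :: ennreal
  proof -
    have "enn2real a \<le> enn2real (b + c)" using that by (intro enn2real_mono) auto
    then show ?thesis using that by (simp add: enn2real_plus)
  qed
  have "\<bar>enn2real (rde_sup d x) - enn2real (rde_sup d y)\<bar> \<le> enn2real ?S"
    using real[OF tri[of x y] fin fin_S] real[OF tri[of y x] fin(2,1) fin_S] x y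
    by (auto simp: abs_minus_commute)
  then have "ennreal (\<bar>enn2real (rde_sup d x) - enn2real (rde_sup d y)\<bar> powr p)
      \<le> ennreal (enn2real ?S powr p)"
    using p by (intro ennreal_leI powr_mono2) auto
  also note S
  finally show ?thesis .
qed (simp add: not_less top_unique)

section \<open>Transport cost and distribution functions\<close>

definition transport_cost :: "real \<Rightarrow> real measure \<Rightarrow> real measure \<Rightarrow> ennreal" where
  "transport_cost p \<mu> \<nu> = (INF \<pi>\<in>couplings \<mu> \<nu>. \<integral>\<^sup>+ z. ennreal (\<bar>fst z - snd z\<bar> powr p) \<partial>\<pi>)"

lemma wass_eq: "wass p \<mu> \<nu> = enn2real (transport_cost p \<mu> \<nu>) powr (1 / p)"
  by (simp add: wass_def transport_cost_def)

lemma wass_nonneg: "0 \<le> wass p \<mu> \<nu>"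
  by (simp add: wass_eq)

lemma transport_cost_le:
  "\<pi> \<in> couplings \<mu> \<nu> \<Longrightarrow>
    transport_cost p \<mu> \<nu> \<le> (\<integral>\<^sup>+ z. ennreal (\<bar>fst z - snd z\<bar> powr p) \<partial>\<pi>)"
  unfolding transport_cost_def by (rule INF_lower)

text \<open>The independent coupling has finite cost. This guards against \<open>enn2real\<close> in
  \<open>wass\<close>, under which an infinite cost would read as distance 0.\<close>

lemma transport_cost_finite:
  assumes "Fp p \<mu>" "Fp p \<nu>" "0 \<le> p"
  shows "transport_cost p \<mu> \<nu> < \<infinity>"
proof -
  interpret \<mu>: real_distribution \<mu> using assms(1) by (rule Fp_real_distribution)
  interpret \<nu>: real_distribution \<nu> using assms(2) by (rule Fp_real_distribution)
  have d: "distr (\<mu> \<Otimes>\<^sub>M \<nu>) borel fst = \<mu>" "distr (\<mu> \<Otimes>\<^sub>M \<nu>) borel snd = \<nu>"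
    using \<nu>.distr_pair_fst[of \<mu>] distr_pair_snd[OF \<mu>.prob_space_axioms \<nu>.sigma_finite_measure_axioms]
    by (auto cong: distr_cong)
  have "\<mu> \<Otimes>\<^sub>M \<nu> \<in> couplings \<mu> \<nu>"
    unfolding couplings_def
    using d prob_space_pair[OF \<mu>.prob_space_axioms \<nu>.prob_space_axioms]
    by (auto intro: sets_pair_measure_cong)
  then have "transport_cost p \<mu> \<nu> \<le> (\<integral>\<^sup>+ z. ennreal (\<bar>fst z - snd z\<bar> powr p) \<partial>(\<mu> \<Otimes>\<^sub>M \<nu>))"
    by (rule transport_cost_le)
  also have "\<dots> \<le> (\<integral>\<^sup>+ z. ennreal (2 powr p) * (ennreal (\<bar>fst z\<bar> powr p) + ennreal (\<bar>snd z\<bar> powr p)) \<partial>(\<mu> \<Otimes>\<^sub>M \<nu>))"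
    by (intro nn_integral_mono)
      (simp add: abs_diff_powr_le[OF assms(3)] ennreal_leI flip: ennreal_mult ennreal_plus)
  also have "\<dots> = ennreal (2 powr p) * ((\<integral>\<^sup>+ z. ennreal (\<bar>fst z\<bar> powr p) \<partial>(\<mu> \<Otimes>\<^sub>M \<nu>))
      + (\<integral>\<^sup>+ z. ennreal (\<bar>snd z\<bar> powr p) \<partial>(\<mu> \<Otimes>\<^sub>M \<nu>)))"
    by (simp add: nn_integral_cmult nn_integral_add)
  also have "(\<integral>\<^sup>+ z. ennreal (\<bar>fst z\<bar> powr p) \<partial>(\<mu> \<Otimes>\<^sub>M \<nu>)) = (\<integral>\<^sup>+ x. ennreal (\<bar>x\<bar> powr p) \<partial>\<mu>)"
    by (subst d(1)[symmetric], subst nn_integral_distr) auto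
  also have "(\<integral>\<^sup>+ z. ennreal (\<bar>snd z\<bar> powr p) \<partial>(\<mu> \<Otimes>\<^sub>M \<nu>)) = (\<integral>\<^sup>+ x. ennreal (\<bar>x\<bar> powr p) \<partial>\<nu>)"
    by (subst d(2)[symmetric], subst nn_integral_distr) auto
  finally show ?thesis
    using assms by (auto simp: Fp_def ennreal_mult_less_top elim!: le_less_trans)
qed

text \<open>If \<open>f \<le> x\<close> while \<open>g\<close> exceeds \<open>x + \<delta>\<close>,
  then \<open>f\<close> and \<open>g\<close> differ by more than \<open>\<delta>\<close>. Markov's
  inequality for the p-th power bounds the probability of that.\<close>

lemma cdf_distr_le:
  assumes "prob_space \<pi>" and [measurable]: "f \<in> borel_measurable \<pi>" "g \<in> borel_measurable \<pi>"
    and "0 < \<delta>" "0 < p"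
  shows "ennreal (\<delta> powr p * (cdf (distr \<pi> borel f) x - cdf (distr \<pi> borel g) (x + \<delta>)))
    \<le> (\<integral>\<^sup>+ z. ennreal (\<bar>f z - g z\<bar> powr p) \<partial>\<pi>)"
proof -
  interpret prob_space \<pi> by fact
  \<comment> \<open>The event that \<open>f\<close> and \<open>g\<close> differ by at least
    \<open>\<delta>\<close>, in the form to which Markov's inequality applies.\<close>
  let ?A = "{z \<in> space \<pi>. 1 \<le> ennreal (1 / \<delta> powr p) * ennreal (\<bar>f z - g z\<bar> powr p)}"
  have A: "z \<in> ?A" if "z \<in> space \<pi>" "f z \<le> x" "\<not> g z \<le> x + \<delta>" for z
  proof -
    have "\<delta> powr p \<le> \<bar>f z - g z\<bar> powr p"
      using that assms by (intro powr_mono2) auto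
    then show ?thesis using that assms by (simp add: field_simps flip: ennreal_mult ennreal_1)
  qed
  have sets [measurable]: "?A \<in> events" by measurable
  have "cdf (distr \<pi> borel f) x = prob {z \<in> space \<pi>. f z \<le> x}"
    unfolding cdf_def by (subst measure_distr) (auto simp: vimage_def Int_def conj_commute)
  also have "\<dots> \<le> prob ({z \<in> space \<pi>. g z \<le> x + \<delta>} \<union> ?A)"
    using A by (intro finite_measure_mono) auto
  also have "\<dots> \<le> prob {z \<in> space \<pi>. g z \<le> x + \<delta>} + prob ?A"
    by (rule measure_Un_le) auto
  also have "prob {z \<in> space \<pi>. g z \<le> x + \<delta>} = cdf (distr \<pi> borel g) (x + \<delta>)"
    unfolding cdf_def by (subst measure_distr) (auto simp: vimage_def Int_def conj_commute)
  finally have "\<delta> powr p * (cdf (distr \<pi> borel f) x - cdf (distr \<pi> borel g) (x + \<delta>)) \<le> \<delta> powr p * prob ?A"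
    by (simp add: mult_left_mono)
  then have "ennreal (\<delta> powr p * (cdf (distr \<pi> borel f) x - cdf (distr \<pi> borel g) (x + \<delta>)))
      \<le> ennreal (\<delta> powr p) * emeasure \<pi> ?A"
    by (simp add: emeasure_eq_measure ennreal_leI flip: ennreal_mult)
  also have "emeasure \<pi> ?A \<le> ennreal (1 / \<delta> powr p)
      * (\<integral>\<^sup>+ z. ennreal (\<bar>f z - g z\<bar> powr p) * indicator (space \<pi>) z \<partial>\<pi>)"
    by (rule nn_integral_Markov_inequality) auto
  also have "(\<integral>\<^sup>+ z. ennreal (\<bar>f z - g z\<bar> powr p) * indicator (space \<pi>) z \<partial>\<pi>)
      = (\<integral>\<^sup>+ z. ennreal (\<bar>f z - g z\<bar> powr p) \<partial>\<pi>)"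
    by (intro nn_integral_cong) auto
  also have "ennreal (\<delta> powr p) * (ennreal (1 / \<delta> powr p) * (\<integral>\<^sup>+ z. ennreal (\<bar>f z - g z\<bar> powr p) \<partial>\<pi>))
      = (\<integral>\<^sup>+ z. ennreal (\<bar>f z - g z\<bar> powr p) \<partial>\<pi>)"
    using \<open>0 < \<delta>\<close> by (simp add: mult.assoc[symmetric] flip: ennreal_mult)
  finally show ?thesis by (simp add: mult_left_mono)
qed

text \<open>The left side of \<open>cdf_distr_le\<close> depends on the marginals alone, so the
  bound survives the infimum over couplings. Exchanging the roles of the two projections gives the
  second inequality.\<close>

lemma cdf_le_wass:
  assumes "Fp p \<mu>" "Fp p \<nu>" "0 < \<delta>" "0 < p"
  shows "cdf \<mu> x \<le> cdf \<nu> (x + \<delta>) + wass p \<mu> \<nu> powr p / \<delta> powr p"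
    and "cdf \<nu> x \<le> cdf \<mu> (x + \<delta>) + wass p \<mu> \<nu> powr p / \<delta> powr p"
proof -
  have fin: "transport_cost p \<mu> \<nu> < \<infinity>"
    using assms by (intro transport_cost_finite) auto
  have w: "wass p \<mu> \<nu> powr p = enn2real (transport_cost p \<mu> \<nu>)"
    using assms by (simp add: wass_eq powr_powr)
  have conv: "a \<le> b + wass p \<mu> \<nu> powr p / \<delta> powr p"
    if "ennreal (\<delta> powr p * (a - b)) \<le> transport_cost p \<mu> \<nu>" for a b
  proof -
    have "ennreal (\<delta> powr p * (a - b)) \<le> ennreal (enn2real (transport_cost p \<mu> \<nu>))"
      using that fin by simp
    then have "\<delta> powr p * (a - b) \<le> enn2real (transport_cost p \<mu> \<nu>)"
      by (simp add: ennreal_le_iff)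
    then have "a - b \<le> wass p \<mu> \<nu> powr p / \<delta> powr p"
      using assms by (simp add: w pos_le_divide_eq mult.commute)
    then show ?thesis by simp
  qed
  have c: "prob_space \<pi>" "fst \<in> borel_measurable \<pi>" "snd \<in> borel_measurable \<pi>"
    "distr \<pi> borel fst = \<mu>" "distr \<pi> borel snd = \<nu>" if "\<pi> \<in> couplings \<mu> \<nu>" for \<pi>
    using that unfolding couplings_def by (auto cong: measurable_cong_sets)
  show "cdf \<mu> x \<le> cdf \<nu> (x + \<delta>) + wass p \<mu> \<nu> powr p / \<delta> powr p"
    unfolding transport_cost_def using cdf_distr_le[OF c(1,2,3) assms(3,4)] c(4,5)
    by (intro conv[unfolded transport_cost_def] INF_greatest) auto
  show "cdf \<nu> x \<le> cdf \<mu> (x + \<delta>) + wass p \<mu> \<nu> powr p / \<delta> powr p"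
    unfolding transport_cost_def using cdf_distr_le[OF c(1,3,2) assms(3,4)] c(4,5)
    by (intro conv[unfolded transport_cost_def] INF_greatest) (auto simp: abs_minus_commute)
qed

lemma wass_imp_weak_conv:
  assumes F: "\<And>n. Fp p (\<mu> n)" "Fp p \<nu>" and p: "0 < p"
    and lim: "(\<lambda>n. wass p (\<mu> n) \<nu>) \<longlonglongrightarrow> 0"
  shows "weak_conv_m \<mu> \<nu>"
  unfolding weak_conv_m_def weak_conv_def
proof (intro allI impI LIMSEQ_I)
  fix x r :: real
  assume "isCont (cdf \<nu>) x" and r: "0 < r"
  then obtain s where s: "0 < s" "\<And>y. \<bar>y - x\<bar> < s \<Longrightarrow> \<bar>cdf \<nu> y - cdf \<nu> x\<bar> < r / 2"
    unfolding continuous_at_eps_delta dist_real_def using half_gt_zero[OF r] by blast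
  \<comment> \<open>With half the radius of continuity, both \<open>x + \<delta>\<close> and
    \<open>x - \<delta>\<close> stay strictly inside the interval where \<open>cdf \<nu>\<close>
    varies by less than \<open>r / 2\<close>; the other half of \<open>r\<close> pays for the
    Wasserstein term.\<close>
  define \<delta> where "\<delta> = s / 2"
  have \<delta>: "0 < \<delta>" using s by (simp add: \<delta>_def)
  have "(\<lambda>n. wass p (\<mu> n) \<nu> powr p / \<delta> powr p) \<longlonglongrightarrow> 0 powr p / \<delta> powr p"
    using p \<delta> by (intro tendsto_intros lim tendsto_powr') (auto simp: wass_eq)
  then have "(\<lambda>n. wass p (\<mu> n) \<nu> powr p / \<delta> powr p) \<longlonglongrightarrow> 0" by simp
  then obtain N where N: "wass p (\<mu> n) \<nu> powr p / \<delta> powr p < r / 2" if "n \<ge> N" for n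
    using order_tendstoD(2)[of _ 0 sequentially "r / 2"] half_gt_zero[OF r]
    unfolding eventually_sequentially by blast
  show "\<exists>no. \<forall>n\<ge>no. norm (cdf (\<mu> n) x - cdf \<nu> x) < r"
  proof (intro exI allI impI)
    fix n assume n: "N \<le> n"
    have "cdf (\<mu> n) x \<le> cdf \<nu> (x + \<delta>) + wass p (\<mu> n) \<nu> powr p / \<delta> powr p"
      "cdf \<nu> (x - \<delta>) \<le> cdf (\<mu> n) x + wass p (\<mu> n) \<nu> powr p / \<delta> powr p"
      using cdf_le_wass(1)[OF F \<delta> p, of n x] cdf_le_wass(2)[OF F \<delta> p, of "x - \<delta>" n] by simp_all
    moreover have "\<bar>cdf \<nu> (x + \<delta>) - cdf \<nu> x\<bar> < r / 2" "\<bar>cdf \<nu> (x - \<delta>) - cdf \<nu> x\<bar> < r / 2"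
      using s(1) by (intro s(2); simp add: \<delta>_def)+
    ultimately show "norm (cdf (\<mu> n) x - cdf \<nu> x) < r"
      using N[OF n] unfolding real_norm_def by linarith
  qed
qed

text \<open>At distance 0 the distribution functions compare up to an arbitrary shift
  \<open>\<delta>\<close>, and right continuity removes the shift.\<close>

lemma wass_eq_0_imp_eq:
  assumes F: "Fp p \<mu>" "Fp p \<nu>" and p: "0 < p" and 0: "wass p \<mu> \<nu> = 0"
  shows "\<mu> = \<nu>"
proof (rule cdf_unique)
  show rd: "real_distribution \<mu>" "real_distribution \<nu>"
    using F by (auto intro: Fp_real_distribution)
  have le: "cdf M x \<le> cdf N x"
    if N: "real_distribution N" and "\<And>\<delta>. 0 < \<delta> \<Longrightarrow> cdf M x \<le> cdf N (x + \<delta>)" for M N x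
  proof -
    interpret real_distribution N by fact
    have "(cdf N \<longlongrightarrow> cdf N x) (at_right x)"
      using cdf_is_right_cont[of x] by (simp add: continuous_within)
    moreover have "\<forall>\<^sub>F y in at_right x. cdf M x \<le> cdf N y"
      using that(2)[of "_ - x"] by (auto simp: eventually_at_filter)
    ultimately show ?thesis
      by (rule tendsto_lowerbound) simp
  qed
  have "cdf \<mu> x \<le> cdf \<nu> x" "cdf \<nu> x \<le> cdf \<mu> x" for x
    using cdf_le_wass[OF F _ p, of _ x] rd p by (auto intro!: le simp: 0)
  then show "cdf \<mu> = cdf \<nu>" by (auto intro: antisym)
qed

section \<open>Contraction of T\<close>

context rde
begin

lemma transport_cost_Tmap_le:
  assumes F: "Fp p \<mu>" "Fp p \<nu>" and p: "1 \<le> p" and c: "cfun D p < \<infinity>" and \<pi>: "\<pi> \<in> couplings \<mu> \<nu>"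
  shows "transport_cost p (Tmap D \<mu>) (Tmap D \<nu>)
    \<le> cfun D p * (\<integral>\<^sup>+ z. ennreal (\<bar>fst z - snd z\<bar> powr p) \<partial>\<pi>)"
proof -
  have prob: "prob_space \<pi>" and m [measurable]: "fst \<in> borel_measurable \<pi>" "snd \<in> borel_measurable \<pi>"
    and marg: "distr \<pi> borel fst = \<mu>" "distr \<pi> borel snd = \<nu>"
    using \<pi> unfolding couplings_def by (auto cong: measurable_cong_sets)
  let ?P = "D \<Otimes>\<^sub>M (\<Pi>\<^sub>M j\<in>(UNIV::nat set). \<pi>)"
  interpret P: prob_space ?P
    by (intro prob_space_pair prob_PiM_UNIV prob_space_axioms prob)
  let ?X = "\<lambda>z. rde_sup (fst z) (\<lambda>j. fst (snd z j))"
  let ?Y = "\<lambda>z. rde_sup (fst z) (\<lambda>j. snd (snd z j))"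
  have mX [measurable]: "?X \<in> borel_measurable ?P" by (rule measurable_rde_sup_compose[OF prob m(1)])
  have mY [measurable]: "?Y \<in> borel_measurable ?P" by (rule measurable_rde_sup_compose[OF prob m(2)])
  \<comment> \<open>Both coordinates use the same data and the same i.i.d. pairs. Projecting the
    pairs gives i.i.d. families with laws \<open>\<mu>\<close> and \<open>\<nu>\<close>, hence the
    right marginals.\<close>
  define \<pi>' where "\<pi>' = distr ?P (borel \<Otimes>\<^sub>M borel) (\<lambda>z. (enn2real (?X z), enn2real (?Y z)))"
  have "\<pi>' \<in> couplings (Tmap D \<mu>) (Tmap D \<nu>)"
    using P.prob_space_distr[of "\<lambda>z. (enn2real (?X z), enn2real (?Y z))" "borel \<Otimes>\<^sub>M borel"]
      Tmap_distr[OF prob m(1)] Tmap_distr[OF prob m(2)]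
    by (simp add: couplings_def \<pi>'_def marg distr_distr comp_def)
  then have "transport_cost p (Tmap D \<mu>) (Tmap D \<nu>) \<le> (\<integral>\<^sup>+ z. ennreal (\<bar>fst z - snd z\<bar> powr p) \<partial>\<pi>')"
    by (rule transport_cost_le)
  also have "\<dots> = (\<integral>\<^sup>+ z. ennreal (\<bar>enn2real (?X z) - enn2real (?Y z)\<bar> powr p) \<partial>?P)"
    unfolding \<pi>'_def by (subst nn_integral_distr) simp_all
  also have "\<dots> \<le> (\<integral>\<^sup>+ z. (\<Sum>j. ennreal ((wgt (fst z) j * \<bar>fst (snd z j) - snd (snd z j)\<bar>) powr p)) \<partial>?P)"
  proof (rule nn_integral_mono_AE)
    have ae: "AE z in D \<Otimes>\<^sub>M (\<Pi>\<^sub>M j\<in>(UNIV::nat set). \<rho>). rde_sup (fst z) (snd z) < \<infinity> \<and> (\<forall>j. 0 \<le> snd z j)"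
      if "Fp p \<rho>" for \<rho>
      using rde_sup_moment(1)[OF that p c] AE_admissible_nonneg[of \<rho>] that
      by (auto simp: Fp_def real_distribution_def)
    have "AE z in ?P. ?X z < \<infinity> \<and> (\<forall>j. 0 \<le> fst (snd z j))"
      by (rule AE_pair_PiM_distr[OF prob m(1), of "\<lambda>d x. rde_sup d x < \<infinity> \<and> (\<forall>j. 0 \<le> x j)"])
        (unfold marg, rule ae[OF F(1)])
    moreover have "AE z in ?P. ?Y z < \<infinity> \<and> (\<forall>j. 0 \<le> snd (snd z j))"
      by (rule AE_pair_PiM_distr[OF prob m(2), of "\<lambda>d x. rde_sup d x < \<infinity> \<and> (\<forall>j. 0 \<le> x j)"])
        (unfold marg, rule ae[OF F(2)])
    ultimately show "AE z in ?P. ennreal (\<bar>enn2real (?X z) - enn2real (?Y z)\<bar> powr p)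
        \<le> (\<Sum>j. ennreal ((wgt (fst z) j * \<bar>fst (snd z j) - snd (snd z j)\<bar>) powr p))"
      by eventually_elim (rule rde_sup_diff_powr_le; use p in simp)
  qed
  also have "\<dots> = cfun D p * (\<integral>\<^sup>+ z. ennreal (\<bar>fst z - snd z\<bar> powr p) \<partial>\<pi>)"
    by (rule nn_integral_wgt_powr[OF prob, of "\<lambda>z. \<bar>fst z - snd z\<bar>"]) auto
  finally show ?thesis .
qed

text \<open>Dividing by c(p) isolates the cost of the coupling, so that the infimum can be taken on
  that side. The case c(p) = 0 is separated because of the division.\<close>

lemma wass_Tmap_le:
  assumes F: "Fp p \<mu>" "Fp p \<nu>" and p: "1 \<le> p" and c: "cfun D p < \<infinity>"
  shows "wass p (Tmap D \<mu>) (Tmap D \<nu>) \<le> enn2real (cfun D p) powr (1 / p) * wass p \<mu> \<nu>"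
proof -
  have fin: "transport_cost p \<mu> \<nu> < \<infinity>"
    using F p by (intro transport_cost_finite) auto
  have "transport_cost p (Tmap D \<mu>) (Tmap D \<nu>) \<le> cfun D p * transport_cost p \<mu> \<nu>"
  proof (cases "cfun D p = 0")
    case True
    \<comment> \<open>An infimum over no couplings would be infinite. Any single coupling then
      bounds the new cost by 0.\<close>
    have "couplings \<mu> \<nu> \<noteq> {}" using fin by (auto simp: transport_cost_def)
    then show ?thesis using transport_cost_Tmap_le[OF F p c] True by force
  next
    case False
    have "transport_cost p (Tmap D \<mu>) (Tmap D \<nu>) / cfun D p \<le> transport_cost p \<mu> \<nu>"
      unfolding transport_cost_def[of p \<mu> \<nu>]
    proof (rule INF_greatest)
      fix \<pi> assume "\<pi> \<in> couplings \<mu> \<nu>"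
      from transport_cost_Tmap_le[OF F p c this]
      show "transport_cost p (Tmap D \<mu>) (Tmap D \<nu>) / cfun D p
          \<le> (\<integral>\<^sup>+ z. ennreal (\<bar>fst z - snd z\<bar> powr p) \<partial>\<pi>)"
        using False c by (intro divide_le_posI_ennreal) (auto simp: zero_less_iff_neq_zero)
    qed
    then have "cfun D p * (transport_cost p (Tmap D \<mu>) (Tmap D \<nu>) / cfun D p)
        \<le> cfun D p * transport_cost p \<mu> \<nu>"
      by (rule mult_left_mono) simp
    then show ?thesis
      using False c by (simp add: ennreal_times_divide ennreal_mult_divide_eq mult.commute[of "cfun D p"])
  qed
  then have "enn2real (transport_cost p (Tmap D \<mu>) (Tmap D \<nu>))
      \<le> enn2real (cfun D p) * enn2real (transport_cost p \<mu> \<nu>)"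
    unfolding enn2real_mult[symmetric] using c fin
    by (intro enn2real_mono) (auto simp: ennreal_mult_less_top)
  then show ?thesis
    using p unfolding wass_eq by (subst powr_mult[symmetric]) (auto intro!: powr_mono2)
qed

end

section \<open>The tree sum as fixed point\<close>

lemma Fp_mono:
  assumes "Fp q \<mu>" "0 \<le> p" "p \<le> q"
  shows "Fp p \<mu>"
proof -
  interpret real_distribution \<mu> using assms(1) by (rule Fp_real_distribution)
  have "\<bar>x\<bar> powr p \<le> 1 + \<bar>x\<bar> powr q" for x :: real
  proof (cases "\<bar>x\<bar> \<le> 1")
    case True
    then have "\<bar>x\<bar> powr p \<le> 1 powr p" using assms by (intro powr_mono2) auto
    then show ?thesis by (simp add: add_increasing2)
  next
    case False
    then have "\<bar>x\<bar> powr p \<le> \<bar>x\<bar> powr q" using assms by (intro powr_mono) auto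
    then show ?thesis by simp
  qed
  then have "(\<integral>\<^sup>+ x. ennreal (\<bar>x\<bar> powr p) \<partial>\<mu>) \<le> (\<integral>\<^sup>+ x. 1 + ennreal (\<bar>x\<bar> powr q) \<partial>\<mu>)"
    by (intro nn_integral_mono) (simp add: ennreal_leI flip: ennreal_plus ennreal_1)
  also have "\<dots> = 1 + (\<integral>\<^sup>+ x. ennreal (\<bar>x\<bar> powr q) \<partial>\<mu>)"
    by (subst nn_integral_add) (use emeasure_space_1 in auto)
  also have "\<dots> < \<infinity>" using assms by (simp add: Fp_def)
  finally show ?thesis using assms by (simp add: Fp_def)
qed

text \<open>Unrolling the recursion along one path and keeping a single child in each supremum can
  only decrease the value. The vertex \<open>u\<close> is arbitrary so that the induction can
  descend to a child.\<close>

lemma path_weight_le_RTP: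
  assumes g: "\<forall>v. admissible (d v)"
    and Y: "\<forall>v. ennreal (Y v) = rde_sup (d v) (\<lambda>j. Y (v @ [j]))"
  shows "in_tree (\<lambda>w. d (u @ w)) v \<Longrightarrow> ennreal (path_weight (\<lambda>w. d (u @ w)) v) \<le> ennreal (Y u)"
proof (induction v arbitrary: u)
  case Nil
  have "ennreal (eta (d u)) \<le> rde_sup (d u) (\<lambda>j. Y (u @ [j]))"
    by (simp add: rde_sup_eq_wgt)
  then show ?case using Y by simp
next
  case (Cons j w)
  then have j: "enat j < NN (d u)" and w: "in_tree (\<lambda>v. d (u @ j # v)) w"
    by (auto simp: in_tree_Cons)
  have IH: "ennreal (path_weight (\<lambda>v. d (u @ j # v)) w) \<le> ennreal (Y (u @ [j]))"
    using Cons.IH[of "u @ [j]"] w by simp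
  have "ennreal (path_weight (\<lambda>w. d (u @ w)) (j # w))
      = ennreal (eta (d u)) + ennreal (wgt (d u) j) * ennreal (path_weight (\<lambda>v. d (u @ j # v)) w)"
    using path_weight_nonneg[of "\<lambda>v. d (u @ j # v)" w] w g j wgt_eq_xi[of "d u" j]
    by (simp add: path_weight_Cons ennreal_mult admissible_def)
  also have "\<dots> \<le> ennreal (eta (d u)) + ennreal (wgt (d u) j) * ennreal (Y (u @ [j]))"
    by (intro add_left_mono mult_left_mono IH) simp
  also have "\<dots> \<le> rde_sup (d u) (\<lambda>j. Y (u @ [j]))"
    unfolding rde_sup_eq_wgt by (intro add_left_mono SUP_upper) simp
  finally show ?case using Y by simp
qed

context rde
begin

section \<open>An exponent with c < 1, and moments of the tree sum\<close>

lemma tree_law_eq: "tree_law D = depth_law \<infinity>"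
  by (simp add: tree_law_def depth_law_def depth_sum_infinity)

text \<open>Weights lie in [0, 1), so high powers of each tend to 0 and are dominated by the power
  \<open>p\<close>. Dominated convergence is applied twice: over the data for each fixed child, and
  then over the children.\<close>

lemma cfun_tendsto_0:
  assumes c: "cfun D p < \<infinity>"
  shows "(\<lambda>n. cfun D (p + real n)) \<longlonglongrightarrow> 0"
proof -
  let ?I = "\<lambda>p j. \<integral>\<^sup>+ d. ennreal (wgt d j powr p) \<partial>D"
  \<comment> \<open>The series is read as an integral for counting measure, so that dominated
    convergence covers it as well.\<close>
  have cI: "cfun D p = (\<integral>\<^sup>+ j. ?I p j \<partial>count_space UNIV)" for p
    by (simp add: cfun_eq_wgt nn_integral_count_space_nat)
  have lt: "AE d in D. wgt d j < 1" for j
    using AE_admissible by eventually_elim (auto simp: admissible_def wgt_def)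
  have le: "AE d in D. ennreal (wgt d j powr (p + real n)) \<le> ennreal (wgt d j powr p)" for j n
    using lt[of j] by eventually_elim (intro ennreal_leI powr_mono', auto)
  have inner: "(\<lambda>n. ?I (p + real n) j) \<longlonglongrightarrow> 0" for j
  proof -
    have "(\<lambda>n. ?I (p + real n) j) \<longlonglongrightarrow> (\<integral>\<^sup>+ d. 0 \<partial>D)"
    proof (rule nn_integral_dominated_convergence[where w="\<lambda>d. ennreal (wgt d j powr p)"])
      have "?I p j \<le> cfun D p"
        unfolding cfun_eq_wgt by (rule term_le_suminf_ennreal)
      then show "?I p j < \<infinity>" using c by (rule le_less_trans)
      show "AE d in D. (\<lambda>n. ennreal (wgt d j powr (p + real n))) \<longlonglongrightarrow> 0"
        using lt[of j]
      proof eventually_elim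
        case (elim d)
        have "(\<lambda>n. wgt d j powr p * wgt d j ^ n) \<longlonglongrightarrow> wgt d j powr p * 0"
          using elim by (intro tendsto_intros LIMSEQ_power_zero) simp
        moreover have "wgt d j powr (p + real n) = wgt d j powr p * wgt d j ^ n" for n
          by (cases "wgt d j = 0") (simp_all add: powr_add powr_realpow less_le)
        ultimately have "(\<lambda>n. wgt d j powr (p + real n)) \<longlonglongrightarrow> 0" by simp
        then show ?case using tendsto_ennrealI by fastforce
      qed
    qed (use le in auto)
    then show ?thesis by simp
  qed
  have I_le: "?I (p + real n) j \<le> ?I p j" for n j
    by (rule nn_integral_mono_AE) (rule le)
  have "(\<lambda>n. cfun D (p + real n)) \<longlonglongrightarrow> (\<integral>\<^sup>+ j. 0 \<partial>count_space (UNIV :: nat set))"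
    unfolding cI
    by (rule nn_integral_dominated_convergence[where w="?I p"])
      (use inner c I_le in \<open>auto simp: cI\<close>)
  then show ?thesis by simp
qed

lemma ex_cfun_less_1:
  assumes "cfun D p < \<infinity>"
  shows "\<exists>q\<ge>r. cfun D q < 1"
proof -
  have "\<forall>\<^sub>F n in sequentially. cfun D (p + real n) < 1"
    by (rule order_tendstoD(2)[OF cfun_tendsto_0[OF assms]]) simp
  moreover have "\<forall>\<^sub>F n in sequentially. r \<le> p + real n"
    by (rule eventually_sequentiallyI[of "nat \<lceil>r - p\<rceil>"]) linarith
  ultimately have "\<forall>\<^sub>F n in sequentially. cfun D (p + real n) < 1 \<and> r \<le> p + real n"
    by eventually_elim simp
  then show ?thesis
    using eventually_happens by fastforce
qed

text \<open>The moments satisfy an affine inequality with slope \<open>q < 1\<close> and start at 0,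
  so they never exceed the fixed point \<open>K\<close> of the affine map.\<close>

lemma depth_law_moment_bounded:
  assumes p: "1 \<le> p" and c: "cfun D p < 1" and e: "(\<integral>\<^sup>+ d. ennreal (eta d powr p) \<partial>D) < \<infinity>"
  obtains K where "\<And>n. (\<integral>\<^sup>+ x. ennreal (\<bar>x\<bar> powr p) \<partial>depth_law (enat n)) \<le> ennreal K"
proof -
  have cfin: "cfun D p < \<infinity>" using c by (rule order.strict_trans) simp
  obtain c' where c': "cfun D p = ennreal c'" "0 \<le> c'" "c' < 1"
    using c by (cases "cfun D p") (auto simp: ennreal_less_iff simp flip: ennreal_1)
  obtain B where B: "(\<integral>\<^sup>+ d. ennreal (eta d powr p) \<partial>D) = ennreal B" "0 \<le> B"
    using e by (cases "\<integral>\<^sup>+ d. ennreal (eta d powr p) \<partial>D") auto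
  \<comment> \<open>\<open>s\<close> plays the role of \<open>1 - l\<close>. Its p-th power is the
    midpoint of \<open>c'\<close> and 1, and \<open>s powr (p - 1)\<close> is at least as large,
    hence above \<open>c'\<close>; this makes the slope \<open>s powr (1 - p) * c'\<close> smaller
    than 1.\<close>
  define s where "s = ((1 + c') / 2) powr (1 / p)"
  have s: "0 < s" "s < 1"
    using c' p powr_less_mono2[of "1 / p" "(1 + c') / 2" 1] by (auto simp: s_def)
  have "c' < (1 + c') / 2" using c' by simp
  also have "\<dots> = s powr p" using p c' by (simp add: s_def powr_powr)
  also have "\<dots> \<le> s powr (p - 1)" using s by (intro powr_mono') auto
  finally have "s powr (1 - p) * c' < s powr (1 - p) * s powr (p - 1)"
    using s by (intro mult_strict_left_mono) auto
  also have "\<dots> = 1" using s by (simp flip: powr_add)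
  finally have q1: "s powr (1 - p) * c' < 1" .
  define q where "q = s powr (1 - p) * c'"
  define A where "A = (1 - s) powr (1 - p) * B"
  define K where "K = A / (1 - q)"
  have q: "0 \<le> q" "q < 1" using q1 c' by (auto simp: q_def)
  have A: "0 \<le> A" using B by (simp add: A_def)
  have K: "0 \<le> K" "A + q * K = K"
    using q A by (auto simp: K_def field_simps)
  have "(\<integral>\<^sup>+ x. ennreal (\<bar>x\<bar> powr p) \<partial>depth_law (enat n)) \<le> ennreal K" for n
  proof (induction n)
    case 0
    then show ?case
      using depth_law_0 by (simp add: nn_integral_return flip: zero_enat_def)
  next
    case (Suc n)
    note it = Tmap_iterates[OF p cfin e, of n]
    have "(\<integral>\<^sup>+ x. ennreal (\<bar>x\<bar> powr p) \<partial>depth_law (enat (Suc n)))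
        = (\<integral>\<^sup>+ x. ennreal (\<bar>x\<bar> powr p) \<partial>Tmap D (depth_law (enat n)))"
      using depth_law_eSuc(1)[OF it(3)] by (simp add: eSuc_enat)
    also have "\<dots> \<le> ennreal ((1 - s) powr (1 - p)) * ennreal B
        + ennreal (s powr (1 - p)) * (ennreal c' * (\<integral>\<^sup>+ x. ennreal (\<bar>x\<bar> powr p) \<partial>depth_law (enat n)))"
      using rde_sup_moment(2)[OF it(2) p cfin, of "1 - s"] s unfolding B c' by simp
    also have "\<dots> \<le> ennreal ((1 - s) powr (1 - p)) * ennreal B
        + ennreal (s powr (1 - p)) * (ennreal c' * ennreal K)"
      by (intro add_left_mono mult_left_mono Suc) auto
    also have "\<dots> = ennreal (A + q * K)"
      unfolding A_def q_def using B c' K(1) by (simp add: ennreal_mult mult.assoc)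
    finally show ?case by (simp add: K)
  qed
  then show ?thesis by (rule that)
qed

lemma tree_sum_moment:
  assumes p: "1 \<le> p" and c: "cfun D p < 1" and e: "(\<integral>\<^sup>+ d. ennreal (eta d powr p) \<partial>D) < \<infinity>"
  shows "AE \<omega> in tree_space D. tree_sum \<omega> < \<infinity>" and "Fp p (tree_law D)"
proof -
  interpret T: prob_space "tree_space D" by (rule prob_tree_space)
  have cfin: "cfun D p < \<infinity>" using c by (rule order.strict_trans) simp
  have p0: "0 < p" using p by simp
  obtain K where K: "(\<integral>\<^sup>+ x. ennreal (\<bar>x\<bar> powr p) \<partial>depth_law (enat n)) \<le> ennreal K" for n
    by (rule depth_law_moment_bounded[OF assms]) blast
  define a where "a \<omega> n = enn2real (depth_sum (enat n) \<omega>)" for \<omega> n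
  have [measurable]: "(\<lambda>\<omega>. a \<omega> n) \<in> borel_measurable (tree_space D)" for n
    unfolding a_def by measurable
  define s where "s \<omega> = (SUP n. ennreal (a \<omega> n powr p))" for \<omega>
  have [measurable]: "s \<in> borel_measurable (tree_space D)"
    unfolding s_def by measurable
  have a0: "0 \<le> a \<omega> n" for \<omega> n by (simp add: a_def)
  have le_s: "ennreal (a \<omega> n powr p) \<le> s \<omega>" for \<omega> n
    unfolding s_def by (rule SUP_upper) simp
  have fin: "AE \<omega> in tree_space D. \<forall>n. depth_sum (enat n) \<omega> < \<infinity>"
    unfolding AE_all_countable using Tmap_iterates(3)[OF p cfin e] by blast
  have SUP_a: "AE \<omega> in tree_space D. tree_sum \<omega> = (SUP n. ennreal (a \<omega> n))"
    using fin by eventually_elim (simp add: tree_sum_eq_SUP a_def)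
  have "(\<integral>\<^sup>+ \<omega>. s \<omega> \<partial>tree_space D) = (SUP n. \<integral>\<^sup>+ \<omega>. ennreal (a \<omega> n powr p) \<partial>tree_space D)"
    unfolding s_def
  \<comment> \<open>Monotonicity holds only almost surely, since \<open>enn2real\<close> preserves
    order only between finite values.\<close>
  proof (rule nn_integral_monotone_convergence_SUP_AE)
    fix n
    show "AE \<omega> in tree_space D. ennreal (a \<omega> n powr p) \<le> ennreal (a \<omega> (Suc n) powr p)"
      using fin
    proof eventually_elim
      case (elim \<omega>)
      then have "a \<omega> n \<le> a \<omega> (Suc n)"
        unfolding a_def using incseq_SucD[OF incseq_depth_sum] by (intro enn2real_mono) auto
      then show ?case using p by (intro ennreal_leI powr_mono2) (auto simp: a0)
    qed
  qed simp
  also have "\<dots> \<le> ennreal K"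
  proof (rule SUP_least)
    fix n
    have "(\<integral>\<^sup>+ x. ennreal (\<bar>x\<bar> powr p) \<partial>depth_law (enat n)) = (\<integral>\<^sup>+ \<omega>. ennreal (a \<omega> n powr p) \<partial>tree_space D)"
      unfolding depth_law_def by (subst nn_integral_distr) (auto simp: a_def)
    then show "(\<integral>\<^sup>+ \<omega>. ennreal (a \<omega> n powr p) \<partial>tree_space D) \<le> ennreal K"
      using K[of n] by (simp only:)
  qed
  also have "\<dots> < \<infinity>" by simp
  finally have s_int: "(\<integral>\<^sup>+ \<omega>. s \<omega> \<partial>tree_space D) < \<infinity>" .
  then have "AE \<omega> in tree_space D. s \<omega> \<noteq> \<infinity>"
    by (intro nn_integral_PInf_AE) auto
  then show "AE \<omega> in tree_space D. tree_sum \<omega> < \<infinity>"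
    using SUP_a
  proof eventually_elim
    case (elim \<omega>)
    then show ?case using powr_SUP_le(2)[OF p0 a0 le_s, of \<omega>] by (simp add: less_top)
  qed
  have "(\<integral>\<^sup>+ x. ennreal (\<bar>x\<bar> powr p) \<partial>tree_law D)
      = (\<integral>\<^sup>+ \<omega>. ennreal (\<bar>enn2real (tree_sum \<omega>)\<bar> powr p) \<partial>tree_space D)"
    unfolding tree_law_def by (rule nn_integral_distr) auto
  also have "\<dots> \<le> (\<integral>\<^sup>+ \<omega>. s \<omega> \<partial>tree_space D)"
  proof (rule nn_integral_mono_AE)
    show "AE \<omega> in tree_space D. ennreal (\<bar>enn2real (tree_sum \<omega>)\<bar> powr p) \<le> s \<omega>"
      using SUP_a by eventually_elim (use powr_SUP_le(1)[OF p0 a0 le_s] in simp)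
  qed
  also note s_int
  finally show "Fp p (tree_law D)"
    by (auto simp: Fp_def tree_law_def AE_distr_iff intro: T.real_distribution_distr)
qed

text \<open>The successor of depth \<infinity> is \<infinity>, so the recursion for depth laws is
  already the fixed point equation.\<close>

lemma Tmap_tree_law:
  assumes "AE \<omega> in tree_space D. tree_sum \<omega> < \<infinity>"
  shows "Tmap D (tree_law D) = tree_law D"
  using depth_law_eSuc(1)[of \<infinity>] assms by (simp add: tree_law_eq depth_sum_infinity)

section \<open>Endogeny\<close>

text \<open>The recursion only gives that the root variable dominates the tree sum of the data;
  both have the same integrable law, so they agree.\<close>
lemma invariant_RTP_imp_endogenous:
  assumes fin: "AE \<omega> in tree_space D. tree_sum \<omega> < \<infinity>" and F: "Fp 1 (tree_law D)"
    and rtp: "invariant_RTP D (tree_law D) M dat Xr"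
  shows "endogenous_at M dat Xr"
proof -
  let ?Omega = "\<Pi>\<^sub>M v\<in>(UNIV::nat list set). Dspace"
  let ?dat = "\<lambda>x v. dat v x"
  have M: "prob_space M" and mdat: "\<And>v. dat v \<in> measurable M Dspace"
    and mX [measurable]: "\<And>v. Xr v \<in> borel_measurable M"
    and law_dat: "distr M ?Omega ?dat = tree_space D"
    and law_X: "\<And>v. distr M borel (Xr v) = tree_law D"
    and rec: "\<And>v. AE x in M. ennreal (Xr v x) = rde_sup (dat v x) (\<lambda>j. Xr (v @ [j]) x)"
    using rtp unfolding invariant_RTP_def tree_space_def by auto
  have m [measurable]: "?dat \<in> measurable M ?Omega"
    using mdat by (intro measurable_PiM_single') (auto simp: space_PiM)
  have mt: "tree_sum \<in> borel_measurable ?Omega"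
    using measurable_tree_sum unfolding tree_space_def
    by (simp cong: measurable_cong_sets add: sets_PiM_cong[OF refl sets_D])
  have mt' [measurable]: "(\<lambda>x. tree_sum (?dat x)) \<in> borel_measurable M"
    by (rule measurable_compose[OF m mt])
  \<comment> \<open>The data have the law \<open>tree_space D\<close> under \<open>M\<close>, so
    almost sure properties of the tree carry over.\<close>
  have good: "AE x in M. \<forall>v. admissible (dat v x)"
    using AE_distrD[OF m, of "\<lambda>\<omega>. \<forall>v. admissible (\<omega> v)"] AE_tree_admissible unfolding law_dat by simp
  have fin': "AE x in M. tree_sum (?dat x) < \<infinity>"
    using AE_distrD[OF m, of "\<lambda>\<omega>. tree_sum \<omega> < \<infinity>"] fin unfolding law_dat by simp
  have "AE x in M. \<forall>v. ennreal (Xr v x) = rde_sup (dat v x) (\<lambda>j. Xr (v @ [j]) x)"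
    unfolding AE_all_countable using rec by blast
  then have le: "AE x in M. tree_sum (?dat x) \<le> ennreal (Xr [] x)"
    using good
  proof eventually_elim
    case (elim x)
    then show ?case
      unfolding tree_sum_def
      using path_weight_le_RTP[of "?dat x" "\<lambda>v. Xr v x" "[]"] by (intro SUP_least) auto
  qed
  have "AE x in distr M borel (Xr []). 0 \<le> x"
    unfolding law_X using F by (simp add: Fp_def)
  then have nonneg: "AE x in M. 0 \<le> Xr [] x"
    by (rule AE_distrD[OF mX])
  have int_X: "(\<integral>\<^sup>+ x. ennreal (Xr [] x) \<partial>M) = (\<integral>\<^sup>+ x. ennreal x \<partial>tree_law D)"
    unfolding law_X[of "[]", symmetric] by (subst nn_integral_distr) auto
  have "(\<integral>\<^sup>+ x. tree_sum (?dat x) \<partial>M) = (\<integral>\<^sup>+ \<omega>. tree_sum \<omega> \<partial>tree_space D)"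
    unfolding law_dat[symmetric] using m mt by (subst nn_integral_distr) auto
  also have "\<dots> = (\<integral>\<^sup>+ \<omega>. ennreal (enn2real (tree_sum \<omega>)) \<partial>tree_space D)"
    by (rule nn_integral_cong_AE) (use fin in \<open>eventually_elim, simp\<close>)
  also have "\<dots> = (\<integral>\<^sup>+ x. ennreal x \<partial>tree_law D)"
    unfolding tree_law_def by (subst nn_integral_distr) auto
  finally have int_t: "(\<integral>\<^sup>+ x. tree_sum (?dat x) \<partial>M) = (\<integral>\<^sup>+ x. ennreal x \<partial>tree_law D)" .
  have "(\<integral>\<^sup>+ x. ennreal x \<partial>tree_law D) \<le> (\<integral>\<^sup>+ x. ennreal (\<bar>x\<bar> powr 1) \<partial>tree_law D)"
    by (intro nn_integral_mono ennreal_leI) (auto simp: powr_one_gt_zero_iff)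
  also have "\<dots> < \<infinity>" using F by (simp add: Fp_def)
  finally have int_fin: "(\<integral>\<^sup>+ x. ennreal x \<partial>tree_law D) < \<infinity>" .
  \<comment> \<open>The difference is nonnegative by \<open>le\<close>, and its integral is the
    difference of two equal finite means.\<close>
  have "(\<integral>\<^sup>+ x. ennreal (Xr [] x) - tree_sum (?dat x) \<partial>M) = 0"
    using int_fin by (subst nn_integral_diff) (use le in \<open>auto simp: int_X int_t\<close>)
  then have "AE x in M. ennreal (Xr [] x) - tree_sum (?dat x) = 0"
    by (subst (asm) nn_integral_0_iff_AE) auto
  then have "AE x in M. Xr [] x = enn2real (tree_sum (?dat x))"
    using le nonneg fin'
  proof eventually_elim
    case (elim x)
    then have "ennreal (Xr [] x) = tree_sum (?dat x)"
      by (intro antisym) (auto simp: diff_eq_0_iff_ennreal less_top)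
    then show ?case using elim by (metis enn2real_ennreal)
  qed
  moreover have "(\<lambda>\<omega>. enn2real (tree_sum \<omega>)) \<in> borel_measurable ?Omega"
    using mt by measurable
  ultimately show ?thesis
    unfolding endogenous_at_def by (intro bexI[of _ "\<lambda>\<omega>. enn2real (tree_sum \<omega>)"])
qed

section \<open>Convergence of iterates and uniqueness\<close>

lemma wass_iterates_tendsto:
  assumes F: "Fp p \<mu>" "Fp p \<nu>" and \<nu>: "Tmap D \<nu> = \<nu>" and p: "1 \<le> p" and c: "cfun D p < 1"
    and e: "(\<integral>\<^sup>+ d. ennreal (eta d powr p) \<partial>D) < \<infinity>"
  shows "Fp p ((Tmap D ^^ n) \<mu>)" and "(\<lambda>n. wass p ((Tmap D ^^ n) \<mu>) \<nu>) \<longlonglongrightarrow> 0"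
proof -
  have cfin: "cfun D p < \<infinity>" using c by (rule order.strict_trans) simp
  let ?r = "enn2real (cfun D p) powr (1 / p)"
  have "enn2real (cfun D p) < 1"
    using c by (cases "cfun D p") (auto simp: ennreal_less_iff simp flip: ennreal_1)
  then have r: "0 \<le> ?r" "?r < 1"
    using p powr_less_mono2[of "1 / p" "enn2real (cfun D p)" 1] by auto
  show Fn: "Fp p ((Tmap D ^^ n) \<mu>)" for n
    by (induction n) (simp_all add: F Fp_Tmap[OF _ p cfin e])
  \<comment> \<open>Since \<open>\<nu>\<close> is fixed by T, each application contracts the
    distance to \<open>\<nu>\<close> itself.\<close>
  have bound: "wass p ((Tmap D ^^ n) \<mu>) \<nu> \<le> ?r ^ n * wass p \<mu> \<nu>" for n
  proof (induction n)
    case (Suc n)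
    have "wass p ((Tmap D ^^ Suc n) \<mu>) \<nu> \<le> ?r * wass p ((Tmap D ^^ n) \<mu>) \<nu>"
      using wass_Tmap_le[OF Fn F(2) p cfin, of n] by (simp add: \<nu>)
    also have "\<dots> \<le> ?r * (?r ^ n * wass p \<mu> \<nu>)"
      using Suc r by (intro mult_left_mono) auto
    finally show ?case by (simp add: mult.assoc)
  qed simp
  have "(\<lambda>n. ?r ^ n * wass p \<mu> \<nu>) \<longlonglongrightarrow> 0 * wass p \<mu> \<nu>"
    using r by (intro tendsto_intros LIMSEQ_power_zero) simp
  then show "(\<lambda>n. wass p ((Tmap D ^^ n) \<mu>) \<nu>) \<longlonglongrightarrow> 0"
    unfolding mult_zero_left
    by (rule tendsto_sandwich[OF always_eventually always_eventually tendsto_const, rotated 2])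
      (simp_all only: bound wass_nonneg simp_thms)
qed

lemma Tmap_fixed_point_unique:
  assumes F: "Fp p \<mu>" "Fp p \<nu>" and fixed: "Tmap D \<mu> = \<mu>" "Tmap D \<nu> = \<nu>"
    and p: "1 \<le> p" and c: "cfun D p < 1" and e: "(\<integral>\<^sup>+ d. ennreal (eta d powr p) \<partial>D) < \<infinity>"
  shows "\<mu> = \<nu>"
proof (rule wass_eq_0_imp_eq[OF F])
  have "(Tmap D ^^ n) \<mu> = \<mu>" for n
    by (induction n) (auto simp: fixed)
  \<comment> \<open>The distances along the iterates of \<open>\<mu>\<close> form a constant
    sequence that tends to 0.\<close>
  then show "wass p \<mu> \<nu> = 0"
    using wass_iterates_tendsto(2)[OF F fixed(2) p c e] by (simp add: LIMSEQ_const_iff)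
qed (use p in simp)

end

theorem theorem32:
  fixes D :: "dat measure"
  assumes "prob_space D" and "sets D = sets Dspace"
    and "AE d in D. 0 \<le> eta d \<and> (\<forall>j. enat j < NN d \<longrightarrow> 0 \<le> xi d j \<and> xi d j < 1)"
    and "\<forall>p\<ge>1. (\<integral>\<^sup>+ d. ennreal (eta d powr p) \<partial>D) < \<infinity>"
    and "\<exists>p\<ge>1. cfun D p < \<infinity>"
  shows "(AE \<omega> in tree_space D. tree_sum \<omega> < \<infinity>)
    \<and> Tmap D (tree_law D) = tree_law D
    \<and> (\<forall>p\<ge>1. Fp p (tree_law D))
    \<and> (\<forall>(M::'a measure) dat Xr. invariant_RTP D (tree_law D) M dat Xr \<longrightarrow> endogenous_at M dat Xr)
    \<and> weak_conv_m (\<lambda>n. (Tmap D ^^ n) (return borel 0)) (tree_law D)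
    \<and> (\<forall>p\<ge>1. cfun D p < 1 \<longrightarrow>
         (\<forall>\<mu>. Fp p \<mu> \<longrightarrow>
             (AE z in D \<Otimes>\<^sub>M (\<Pi>\<^sub>M j\<in>(UNIV::nat set). \<mu>). rde_sup (fst z) (snd z) < \<infinity>)
             \<and> Fp p (Tmap D \<mu>))
       \<and> (\<forall>\<mu>1 \<mu>2. Fp p \<mu>1 \<longrightarrow> Fp p \<mu>2 \<longrightarrow>
             wass p (Tmap D \<mu>1) (Tmap D \<mu>2) \<le> enn2real (cfun D p) powr (1 / p) * wass p \<mu>1 \<mu>2)
       \<and> (\<forall>\<nu>. Fp p \<nu> \<longrightarrow> Tmap D \<nu> = \<nu> \<longrightarrow> \<nu> = tree_law D)
       \<and> (\<forall>\<mu>0. Fp p \<mu>0 \<longrightarrow> (\<lambda>n. wass p ((Tmap D ^^ n) \<mu>0) (tree_law D)) \<longlonglongrightarrow> 0))"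
proof -
  interpret rde D
    using assms(1-3) by (simp add: rde_def rde_axioms_def admissible_def)
  note eta_moment = assms(4)[rule_format]
  obtain p0 where "cfun D p0 < \<infinity>" using assms(5) by blast
  note ex = ex_cfun_less_1[OF this]
  obtain q where q: "1 \<le> q" "cfun D q < 1" using ex by blast
  have fin: "AE \<omega> in tree_space D. tree_sum \<omega> < \<infinity>"
    by (rule tree_sum_moment(1)[OF q eta_moment[OF q(1)]])
  have F: "Fp p (tree_law D)" if "1 \<le> p" for p
  proof -
    \<comment> \<open>At the given \<open>p\<close> the value c(p) may be 1 or more, even infinite.
      The moment is obtained at a higher exponent with c < 1 and then brought down to
      \<open>p\<close>.\<close>
    obtain r where r: "p \<le> r" "cfun D r < 1" using ex by blast
    then have "Fp r (tree_law D)"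
      using that by (intro tree_sum_moment(2) eta_moment) auto
    then show ?thesis by (rule Fp_mono) (use r that in auto)
  qed
  note fixed = Tmap_tree_law[OF fin]
  have weak: "weak_conv_m (\<lambda>n. (Tmap D ^^ n) (return borel 0)) (tree_law D)"
    using wass_iterates_tendsto[OF Fp_return_0 F[OF q(1)] fixed q eta_moment[OF q(1)]] q
    by (intro wass_imp_weak_conv[of q] F) auto
  have cfin: "cfun D p < \<infinity>" if "cfun D p < 1" for p
    using that by (rule order.strict_trans) simp
  have rtp: "\<forall>(M::'a measure) dat Xr. invariant_RTP D (tree_law D) M dat Xr \<longrightarrow> endogenous_at M dat Xr"
    using invariant_RTP_imp_endogenous[OF fin F[OF order_refl]] by blast
  show ?thesis
  proof (intro conjI rtp fin fixed weak allI impI)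
    fix p :: real assume p: "1 \<le> p"
    show "Fp p (tree_law D)" by (rule F[OF p])
    assume c: "cfun D p < 1"
    fix \<mu> \<nu> assume \<mu>: "Fp p \<mu>"
    show "AE z in D \<Otimes>\<^sub>M (\<Pi>\<^sub>M j\<in>(UNIV::nat set). \<mu>). rde_sup (fst z) (snd z) < \<infinity>"
      by (rule rde_sup_moment(1)[OF \<mu> p cfin[OF c]])
    show "Fp p (Tmap D \<mu>)"
      by (rule Fp_Tmap[OF \<mu> p cfin[OF c] eta_moment[OF p]])
    show "wass p (Tmap D \<mu>) (Tmap D \<nu>) \<le> enn2real (cfun D p) powr (1 / p) * wass p \<mu> \<nu>" if "Fp p \<nu>"
      by (rule wass_Tmap_le[OF \<mu> that p cfin[OF c]])
    show "\<mu> = tree_law D" if "Tmap D \<mu> = \<mu>"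
      by (rule Tmap_fixed_point_unique[OF \<mu> F[OF p] that fixed p c eta_moment[OF p]])
    show "(\<lambda>n. wass p ((Tmap D ^^ n) \<mu>) (tree_law D)) \<longlonglongrightarrow> 0"
      by (rule wass_iterates_tendsto(2)[OF \<mu> F[OF p] fixed p c eta_moment[OF p]])
  qed
qed

end
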